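(* Let $n\ge d$, $1\le k<d$, let $A\in\mathbb{R}^{n\times d}$, let $\tilde A=A+E$ be its entrywise stochastic rounding with resolution $\rho$, assume that $A$ and $\tilde A$ both have full column rank, and write $\sigma_i=\sigma_i(A)$, $\lambda_i=\sigma_i^2$. There exist absolute constants $c_1,c_2,c_3,c_g>0$ such that, if $$\rho\sqrt{nd}\le c_1\sigma_k,\qquad \sigma_1\le c_2\sigma_k,\qquad d\ge c_3\sqrt n,\qquad g:=\lambda_k-\lambda_{k+1}>c_g\lambda_k,$$ then there is a constant $C>0$ such that $$\mathcal{T}\ \ge\ \sum_{j=k+1}^d\nu_j^\downarrow-C\left(k(d-k)\rho^2+\frac{k\,n^2\rho^4}{\sigma_k^2}+\frac{d^{5/2}\rho^3}{\sigma_k}\right).$$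
   Context: Stochastic rounding (uniformly dithered quantizer): given $R>0$ with $|A_{ij}|\le R$ for all $i,j$ and an integer bit-budget $B\ge 1$, let $M=2^B$, let $q_1<\dots<q_M$ be evenly spaced points with $q_1=-R$, $q_M=R$, and let $\rho=2R/(M-1)$ be the spacing (resolution). For $x\in[q_m,q_{m+1}]$, $Q_\rho(x)=q_{m+1}$ with probability $(x-q_m)/\rho$ and $Q_\rho(x)=q_m$ otherwise. The matrix $\tilde A$ has entries $\tilde A_{ij}=Q_\rho(A_{ij})$, rounded independently over $(i,j)$, and $E=\tilde A-A$. Thus the entries of $E$ are independent, centered, satisfy $|E_{ij}|\le\rho$, and $\mathrm{Var}(E_{ij})\le\rho^2/4$. $\sigma_1(\cdot)\ge\dots\ge\sigma_d(\cdot)$ are singular values. $\nu_j=\sum_{i=1}^n\mathrm{Var}(E_{ij})$, and $\nu_1^\downarrow\ge\dots\ge\nu_d^\downarrow$ is the decreasing rearrangement of $\nu_1,\dots,\nu_d$. The expected excess tail energy is $$\mathcal{T}=\mathbb{E}\left[\sum_{i=k+1}^d\sigma_i(\tilde A)^2\right]-\sum_{i=k+1}^d\sigma_i(A)^2 .$$ *)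

theory Defs
  imports
    "HOL-Probability.Product_PMF"
    "HOL-Computational_Algebra.Polynomial"
    "Jordan_Normal_Form.DL_Rank"
    "Jordan_Normal_Form.Char_Poly"
begin

text \<open>
  Dimensions vary under the quantifiers of the main statement, so real $n \times d$ matrices are
  elements of \<^term>\<open>carrier_mat n d\<close>. Matrix indices start at 0, whereas grid points, singular
  values and decreasing rearrangements are numbered from 1.
\<close>

definition kth_largest :: "real multiset \<Rightarrow> nat \<Rightarrow> real" where
  "kth_largest M i = rev (sorted_list_of_multiset M) ! (i - 1)"

text \<open>
  All roots of the characteristic polynomial of the symmetric positive semidefinite Gram matrix
  are real and nonnegative, so the multiset below has as many elements as \<open>A\<close> has columns.
\<close>
definition singular_value :: "real mat \<Rightarrow> nat \<Rightarrow> real" where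
  "singular_value A = kth_largest (image_mset sqrt (proots (char_poly (transpose_mat A * A))))"

definition full_column_rank :: "real mat \<Rightarrow> bool" where
  "full_column_rank A \<longleftrightarrow> vec_space.rank (dim_row A) A = dim_col A"

definition resolution :: "real \<Rightarrow> nat \<Rightarrow> real" where
  "resolution R B = 2 * R / (2 ^ B - 1)"

definition grid_point :: "real \<Rightarrow> nat \<Rightarrow> nat \<Rightarrow> real" where
  "grid_point R B m = - R + (real m - 1) * resolution R B"

text \<open>
  If \<open>x\<close> is an interior grid point, it lies in two cells, but both choices of the cell
  give the point mass at \<open>x\<close>.
\<close>
definition grid_cell :: "real \<Rightarrow> nat \<Rightarrow> real \<Rightarrow> nat" where
  "grid_cell R B x = (LEAST m. 1 \<le> m \<and> m < 2 ^ B \<and> x \<in> {grid_point R B m .. grid_point R B (m + 1)})"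

definition stochastic_round :: "real \<Rightarrow> nat \<Rightarrow> real \<Rightarrow> real pmf" where
  "stochastic_round R B x =
     (let m = grid_cell R B x
      in map_pmf (\<lambda>up. if up then grid_point R B (m + 1) else grid_point R B m)
           (bernoulli_pmf ((x - grid_point R B m) / resolution R B)))"

text \<open>The joint law of the independently rounded entries.\<close>
definition stochastic_round_mat :: "real \<Rightarrow> nat \<Rightarrow> real mat \<Rightarrow> real mat pmf" where
  "stochastic_round_mat R B A =
     map_pmf (mat (dim_row A) (dim_col A))
       (Pi_pmf ({..<dim_row A} \<times> {..<dim_col A}) 0 (\<lambda>(i, j). stochastic_round R B (A $$ (i, j))))"

definition column_variance :: "real \<Rightarrow> nat \<Rightarrow> real mat \<Rightarrow> nat \<Rightarrow> real" where
  "column_variance R B A j =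
     (\<Sum>i<dim_row A. measure_pmf.variance (stochastic_round_mat R B A) (\<lambda>A'. (A' - A) $$ (i, j)))"

definition column_variance_decr :: "real \<Rightarrow> nat \<Rightarrow> real mat \<Rightarrow> nat \<Rightarrow> real" where
  "column_variance_decr R B A =
     kth_largest (image_mset (column_variance R B A) (mset_set {..<dim_col A}))"

definition excess_tail_energy :: "real \<Rightarrow> nat \<Rightarrow> real mat \<Rightarrow> nat \<Rightarrow> real" where
  "excess_tail_energy R B A k =
     measure_pmf.expectation (stochastic_round_mat R B A)
       (\<lambda>A'. \<Sum>i = k + 1..dim_col A. (singular_value A' i)\<^sup>2)
     - (\<Sum>i = k + 1..dim_col A. (singular_value A i)\<^sup>2)"

end

(* Let u be the right singular vectors of A and write A' = A + E. In the basis u the Gram matrix of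
   A' has blocks M11 (the first k vectors), M22 and M12. The squared Frobenius norm of E is at most
   n d rho^2, so smallness of rho and the gap separate M11 from M22 for every outcome, by some
   delta >= lambda_k / 4. Completing the square in the off-diagonal block then bounds the top-k
   energy of A' by tr M11 + ||M12||_F^2 / delta. In expectation tr M11 is the top-k energy of A plus
   a weighted sum of the column variances with weights in [0,1] of total mass k, hence at most plus
   the k largest variances; and E ||M12||_F^2 is a second and fourth moment computation. The total
   energy of A' exceeds that of A by the sum of all column variances in expectation, and subtracting
   gives the bound on the tail. *)
theory Submission
  imports Defs "Jordan_Normal_Form.Spectral_Radius"
begin

unbundle no vec_syntax

subsection \<open>Spectral theorem and singular vectors\<close>

text \<open>The obstacle is that the right singular vectors of A + E depend on E, so expectations
  along them cannot be computed. The block bound is therefore proved for each outcome and any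
  orthonormal basis, with a right side that mentions only the fixed basis u; what is averaged is an
  explicit polynomial in independent entries. Hence separation must hold surely, and the Frobenius
  norm, bounded outright, stands in for the operator norm. The off-diagonal entries are <A u_b, E
  u_c> + <E u_b, A u_c> + <E u_b, E u_c>. The first two have second moment at most lambda_1 rho^2,
  whence k (d - k) rho^2 after division by delta. The last is summed over c by Parseval before
  averaging, which gives at most 4 n^2 rho^4 for each b. The inequality (p + q + s)^2 <= 3 (p^2 +
  q^2 + s^2) avoids third moments. Constants: c_1 = 1/64 makes the squared norm of E at most
  lambda_k / 4096, c_g = 1/2 puts lambda_{k+1} below lambda_k / 2, c_2 = 2 gives lambda_1 <= 4
  lambda_k, and C = 96 = (4 / lambda_k) * 6 * (4 lambda_k).\<close>

text \<open>The complex spectrum is nonempty. The form w* G w equals mu |w|^2 and is its own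
  conjugate by symmetry, so mu is real; then the real and imaginary parts of w both satisfy the
  eigenvector equation, and one of them is nonzero.\<close>

lemma symmetric_mat_real_eigenvector:
  fixes G :: "real mat"
  assumes G: "G \<in> carrier_mat n n" and sym: "transpose_mat G = G" and n: "0 < n"
  obtains e v where "v \<in> carrier_vec n" "v \<noteq> 0\<^sub>v n" "G *\<^sub>v v = e \<cdot>\<^sub>v v"
proof -
  define Gc where "Gc = map_mat complex_of_real G"
  have Gc: "Gc \<in> carrier_mat n n" using G by (simp add: Gc_def)
  from spectrum_non_empty[OF Gc n] obtain \<mu> w where ev: "eigenvector Gc w \<mu>"
    unfolding spectrum_def eigenvalue_def by auto
  have w: "w \<in> carrier_vec n" "w \<noteq> 0\<^sub>v n" and Gw: "Gc *\<^sub>v w = \<mu> \<cdot>\<^sub>v w"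
    using ev G Gc by (auto simp: eigenvector_def)
  have symij: "G $$ (i, j) = G $$ (j, i)" if "i < n" "j < n" for i j
    using arg_cong[OF sym, of "\<lambda>M. M $$ (j, i)"] G that by simp
  have comp: "(\<Sum>j<n. complex_of_real (G $$ (i, j)) * w $ j) = \<mu> * w $ i" if i: "i < n" for i
    using arg_cong[OF Gw, of "\<lambda>v. v $ i"] i w(1) G
    by (simp add: Gc_def scalar_prod_def lessThan_atLeast0)
  define S where "S = (\<Sum>i<n. cnj (w $ i) * w $ i)"
  have S_real: "S = complex_of_real (\<Sum>i<n. (norm (w $ i))\<^sup>2)"
    unfolding S_def of_real_sum
    by (intro sum.cong refl) (metis complex_norm_square mult.commute of_real_power)
  obtain i0 where i0: "i0 < n" "w $ i0 \<noteq> 0"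
    using w by (metis carrier_vecD eq_vecI index_zero_vec(1) index_zero_vec(2))
  have "(norm (w $ i0))\<^sup>2 \<le> (\<Sum>i<n. (norm (w $ i))\<^sup>2)"
    using i0 by (intro member_le_sum) auto
  hence S0: "S \<noteq> 0" unfolding S_real using i0 by (smt (verit) of_real_eq_0_iff zero_less_norm_iff zero_less_power)
  define Q where "Q = (\<Sum>i<n. \<Sum>j<n. cnj (w $ i) * (complex_of_real (G $$ (i, j)) * w $ j))"
  have Q: "Q = \<mu> * S"
    unfolding Q_def S_def sum_distrib_left[symmetric]
    unfolding sum_distrib_left by (intro sum.cong refl) (simp add: comp flip: sum_distrib_left)
  have "cnj Q = (\<Sum>i<n. \<Sum>j<n. w $ i * (complex_of_real (G $$ (i, j)) * cnj (w $ j)))"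
    by (simp add: Q_def)
  also have "\<dots> = (\<Sum>j<n. \<Sum>i<n. w $ i * (complex_of_real (G $$ (i, j)) * cnj (w $ j)))"
    by (rule sum.swap)
  also have "\<dots> = Q"
    unfolding Q_def by (intro sum.cong refl) (simp add: symij mult_ac)
  finally have "cnj \<mu> * S = \<mu> * S" using Q S_real by simp
  hence "cnj \<mu> = \<mu>" using S0 by simp
  hence Im0: "Im \<mu> = 0" by (simp add: complex_eq_iff)
  have Re: "(\<Sum>j<n. G $$ (i, j) * Re (w $ j)) = Re \<mu> * Re (w $ i)" if "i < n" for i
    using arg_cong[OF comp[OF that], of Re] Im0 by simp
  have Im: "(\<Sum>j<n. G $$ (i, j) * Im (w $ j)) = Re \<mu> * Im (w $ i)" if "i < n" for i
    using arg_cong[OF comp[OF that], of Im] Im0 by simp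
  show ?thesis
  proof (cases "Re (w $ i0) = 0")
    case False
    show ?thesis
    proof (rule that[of "vec n (\<lambda>i. Re (w $ i))" "Re \<mu>"])
      show "vec n (\<lambda>i. Re (w $ i)) \<noteq> 0\<^sub>v n"
        using False i0 by (metis index_vec index_zero_vec(1))
      show "G *\<^sub>v vec n (\<lambda>i. Re (w $ i)) = Re \<mu> \<cdot>\<^sub>v vec n (\<lambda>i. Re (w $ i))"
        using G Re by (intro eq_vecI) (auto simp: scalar_prod_def lessThan_atLeast0)
    qed simp
  next
    case True
    hence "Im (w $ i0) \<noteq> 0" using i0 by (simp add: complex_eq_iff)
    show ?thesis
    proof (rule that[of "vec n (\<lambda>i. Im (w $ i))" "Re \<mu>"])
      show "vec n (\<lambda>i. Im (w $ i)) \<noteq> 0\<^sub>v n"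
        using \<open>Im (w $ i0) \<noteq> 0\<close> i0 by (metis index_vec index_zero_vec(1))
      show "G *\<^sub>v vec n (\<lambda>i. Im (w $ i)) = Re \<mu> \<cdot>\<^sub>v vec n (\<lambda>i. Im (w $ i))"
        using G Im by (intro eq_vecI) (auto simp: scalar_prod_def lessThan_atLeast0)
    qed simp
  qed
qed

text \<open>Completes a unit vector v to an orthonormal basis with a single reflection, the one in
  the hyperplane orthogonal to v - e_0, which swaps e_0 and v.\<close>

lemma householder_reflection:
  fixes v :: "real vec"
  assumes v: "v \<in> carrier_vec n" and unit: "v \<bullet> v = 1" and n: "0 < n"
  obtains W where "W \<in> carrier_mat n n" "transpose_mat W = W" "W * W = 1\<^sub>m n"
    "W *\<^sub>v unit_vec n 0 = v"
proof -
  define u where "u i = v $ i - (if i = 0 then 1 else 0)" for i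
  define s where "s = (\<Sum>i<n. u i * u i)"
  \<comment> \<open>If v is already e_0, then s = 0 and W becomes the identity.\<close>
  define c where "c = (if s = 0 then 0 else 2 / s)"
  define W where "W = mat n n (\<lambda>(i, j). (if i = j then 1 else 0) - c * u i * u j)"
  have v1: "(\<Sum>i<n. v $ i * v $ i) = 1"
    using unit v by (simp add: scalar_prod_def lessThan_atLeast0)
  have "s = (\<Sum>i<n. v $ i * v $ i - (if i = 0 then 2 * v $ i - 1 else 0))"
    unfolding s_def u_def by (intro sum.cong) (auto simp: algebra_simps)
  also have "\<dots> = 2 - 2 * v $ 0"
    using n v1 by (simp add: sum_subtractf sum.delta)
  finally have s: "s = 2 - 2 * v $ 0" .
  have cs: "c * c * s = 2 * c" by (simp add: c_def)
  \<comment> \<open>Since v has norm 1, s = 2 - 2 v_0 = -2 u_0, so \<open>c * u 0\<close> is -1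
    unless u vanishes.\<close>
  have cu: "- c * u i * u 0 = u i" if "i < n" for i
  proof (cases "s = 0")
    case True
    hence "u i * u i = 0"
      using that sum_nonneg_eq_0_iff[of "{..<n}" "\<lambda>i. u i * u i"] by (auto simp: s_def)
    thus ?thesis by simp
  next
    case False
    have "u 0 = - (s / 2)" using s by (simp add: u_def field_simps)
    thus ?thesis using False by (simp add: c_def)
  qed
  show ?thesis
  proof (rule that[of W])
    show "W \<in> carrier_mat n n" by (simp add: W_def)
    show "transpose_mat W = W" by (rule eq_matI) (auto simp: W_def)
    show "W * W = 1\<^sub>m n"
    proof (rule eq_matI)
      fix i j assume "i < dim_row (1\<^sub>m n :: real mat)" "j < dim_col (1\<^sub>m n :: real mat)"
      hence ij: "i < n" "j < n" by auto
      let ?d = "\<lambda>i j. if i = j then 1 else (0::real)"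
      have "(W * W) $$ (i, j) = (\<Sum>k<n. (?d i k - c * u i * u k) * (?d k j - c * u k * u j))"
        using ij by (simp add: W_def scalar_prod_def lessThan_atLeast0)
      also have "\<dots> = (\<Sum>k<n. (if k = i then ?d i j - c * u i * u j else 0)
          - (if k = j then c * u i * u j else 0) + c * c * u i * u j * (u k * u k))"
        by (intro sum.cong refl) (auto simp: algebra_simps)
      also have "\<dots> = ?d i j - 2 * c * u i * u j + (c * c * s) * u i * u j"
        using ij by (simp add: sum.distrib sum_subtractf sum.delta s_def sum_distrib_left[symmetric])
      also have "\<dots> = ?d i j" by (simp add: cs)
      finally show "(W * W) $$ (i, j) = 1\<^sub>m n $$ (i, j)" using ij by simp
    qed (auto simp: W_def)
    show "W *\<^sub>v unit_vec n 0 = v"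
    proof (rule eq_vecI)
      fix i assume "i < dim_vec v"
      hence i: "i < n" using v by simp
      have "(W *\<^sub>v unit_vec n 0) $ i = (if i = 0 then 1 else 0) - c * u i * u 0"
        using i n by (simp add: W_def)
      thus "(W *\<^sub>v unit_vec n 0) $ i = v $ i" using cu[OF i] by (simp add: u_def split: if_splits)
    qed (use v in \<open>auto simp: W_def\<close>)
  qed
qed

text \<open>Deflation: conjugating with the reflection W that sends e_0 to an eigenvector makes the
  first column a multiple of e_0, symmetry clears the first row too, and the induction hypothesis
  diagonalises the remaining block.\<close>

theorem symmetric_mat_spectral:
  fixes G :: "real mat"
  assumes "G \<in> carrier_mat n n" "transpose_mat G = G"
  shows "\<exists>U \<mu>. U \<in> carrier_mat n n \<and> transpose_mat U * U = 1\<^sub>m n \<and>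
    transpose_mat U * G * U = mat_diag n \<mu>"
  using assms
proof (induction n arbitrary: G)
  case 0
  show ?case by (intro exI[of _ "1\<^sub>m 0"] exI[of _ "\<lambda>_. 0"]) (use 0 in \<open>auto simp: mat_diag_def intro!: eq_matI\<close>)
next
  case (Suc m)
  let ?n = "Suc m"
  note G = Suc.prems(1) and sym = Suc.prems(2)
  obtain e v0 where v0: "v0 \<in> carrier_vec ?n" "v0 \<noteq> 0\<^sub>v ?n" "G *\<^sub>v v0 = e \<cdot>\<^sub>v v0"
    using symmetric_mat_real_eigenvector[OF G sym] by blast
  define r where "r = v0 \<bullet> v0"
  have "r = (\<Sum>i<?n. (v0 $ i)\<^sup>2)"
    using v0 by (simp add: r_def scalar_prod_def lessThan_atLeast0 power2_eq_square)
  moreover obtain i where "i < ?n" "v0 $ i \<noteq> 0"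
    using v0 by (metis carrier_vecD eq_vecI index_zero_vec(1) index_zero_vec(2))
  ultimately have r: "r > 0"
    by (metis finite_lessThan lessThan_iff sum_pos2 zero_le_power2 zero_less_power2)
  define v where "v = (1 / sqrt r) \<cdot>\<^sub>v v0"
  have v: "v \<in> carrier_vec ?n" using v0 by (simp add: v_def)
  have vv: "v \<bullet> v = 1"
    using v0 r by (simp add: v_def r_def[symmetric] smult_scalar_prod_distrib[of _ ?n])
  have Gv: "G *\<^sub>v v = e \<cdot>\<^sub>v v"
    using G v0 by (simp add: v_def mult_mat_vec smult_smult_assoc mult.commute)
  obtain W where W: "W \<in> carrier_mat ?n ?n" "transpose_mat W = W" "W * W = 1\<^sub>m ?n"
    "W *\<^sub>v unit_vec ?n 0 = v"
    using householder_reflection[OF v vv] by auto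
  define G1 where "G1 = W * G * W"
  have G1: "G1 \<in> carrier_mat ?n ?n" using W G by (simp add: G1_def)
  have symG1: "transpose_mat G1 = G1"
    using transpose_mult[of "W * G" ?n ?n W ?n] transpose_mult[of W ?n ?n G ?n]
      assoc_mult_mat[of W ?n ?n G ?n W ?n] W(1,2) G sym
    by (simp add: G1_def del: assoc_mult_mat)
  have Wv: "W *\<^sub>v v = unit_vec ?n 0"
    using W by (metis assoc_mult_mat_vec one_mult_mat_vec unit_vec_carrier)
  have "G1 *\<^sub>v unit_vec ?n 0 = W * G *\<^sub>v (W *\<^sub>v unit_vec ?n 0)"
    unfolding G1_def by (rule assoc_mult_mat_vec[of _ ?n ?n _ ?n]) (use W(1) G in auto)
  also have "\<dots> = W *\<^sub>v (G *\<^sub>v (W *\<^sub>v unit_vec ?n 0))"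
    by (rule assoc_mult_mat_vec[of _ ?n ?n _ ?n]) (use W(1) G in auto)
  also have "\<dots> = e \<cdot>\<^sub>v unit_vec ?n 0"
    using W v by (simp add: Gv mult_mat_vec[of _ ?n ?n] Wv)
  finally have G1e: "G1 *\<^sub>v unit_vec ?n 0 = e \<cdot>\<^sub>v unit_vec ?n 0" .
  have col0: "G1 $$ (i, 0) = (if i = 0 then e else 0)" if "i < ?n" for i
    using arg_cong[OF G1e, of "\<lambda>x. x $ i"] that G1 by simp
  have symij: "G1 $$ (i, j) = G1 $$ (j, i)" if "i < ?n" "j < ?n" for i j
    using arg_cong[OF symG1, of "\<lambda>M. M $$ (j, i)"] G1 that by simp
  define G2 where "G2 = mat m m (\<lambda>(i, j). G1 $$ (Suc i, Suc j))"
  let ?D1 = "mat 1 1 (\<lambda>_. e)"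
  have blk: "G1 = four_block_mat ?D1 (0\<^sub>m 1 m) (0\<^sub>m m 1) G2"
  proof (rule eq_matI)
    fix i j assume "i < dim_row (four_block_mat ?D1 (0\<^sub>m 1 m) (0\<^sub>m m 1) G2)"
      "j < dim_col (four_block_mat ?D1 (0\<^sub>m 1 m) (0\<^sub>m m 1) G2)"
    hence ij: "i < ?n" "j < ?n" by (auto simp: G2_def)
    show "G1 $$ (i, j) = four_block_mat ?D1 (0\<^sub>m 1 m) (0\<^sub>m m 1) G2 $$ (i, j)"
      using ij col0[of i] col0[of j] symij[of 0 j] by (auto simp: G2_def)
  qed (use G1 in \<open>auto simp: G2_def\<close>)
  have G2: "G2 \<in> carrier_mat m m" "transpose_mat G2 = G2"
    by (auto simp: G2_def symij intro!: eq_matI)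
  obtain U2 \<mu>2 where U2: "U2 \<in> carrier_mat m m" "transpose_mat U2 * U2 = 1\<^sub>m m"
    "transpose_mat U2 * G2 * U2 = mat_diag m \<mu>2"
    using Suc.IH[OF G2] by blast
  define V where "V = four_block_mat (1\<^sub>m 1) (0\<^sub>m 1 m) (0\<^sub>m m 1) U2"
  have V: "V \<in> carrier_mat ?n ?n" using U2 by (auto simp: V_def)
  have VT: "transpose_mat V = four_block_mat (1\<^sub>m 1) (0\<^sub>m 1 m) (0\<^sub>m m 1) (transpose_mat U2)"
    unfolding V_def using U2 by (subst transpose_four_block_mat) auto
  have VV: "transpose_mat V * V = 1\<^sub>m ?n"
    unfolding VT unfolding V_def
    by (subst mult_four_block_mat[of _ 1 1 _ m _ m _ _ 1 _ m])
      (use U2 in \<open>auto intro!: eq_matI\<close>)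
  have VGV: "transpose_mat V * G1 * V = mat_diag ?n (case_nat e \<mu>2)"
  proof -
    have "transpose_mat V * G1 = four_block_mat ?D1 (0\<^sub>m 1 m) (0\<^sub>m m 1) (transpose_mat U2 * G2)"
      unfolding VT blk
      by (subst mult_four_block_mat[of _ 1 1 _ m _ m _ _ 1 _ m]) (use U2 G2 in auto)
    hence "transpose_mat V * G1 * V
        = four_block_mat ?D1 (0\<^sub>m 1 m) (0\<^sub>m m 1) (transpose_mat U2 * G2 * U2)"
      unfolding V_def
      by (simp, subst mult_four_block_mat[of _ 1 1 _ m _ m _ _ 1 _ m]) (use U2 G2 in auto)
    also have "\<dots> = mat_diag ?n (case_nat e \<mu>2)"
      unfolding U2(3) by (rule eq_matI) (auto simp: mat_diag_def split: nat.splits)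
    finally show ?thesis .
  qed
  have T: "transpose_mat (W * V) = transpose_mat V * W"
    using W V by (simp add: transpose_mult[of _ ?n ?n])
  have VTc: "transpose_mat V \<in> carrier_mat ?n ?n" using V by simp
  note assoc = assoc_mult_mat[of _ ?n ?n _ ?n _ ?n]
  show ?case
  proof (intro exI conjI)
    show "W * V \<in> carrier_mat ?n ?n" using W V by simp
    have "transpose_mat (W * V) * (W * V) = transpose_mat V * (W * W * V)"
      unfolding T using W(1) V VTc by (simp add: assoc)
    thus "transpose_mat (W * V) * (W * V) = 1\<^sub>m ?n" using V VV by (simp add: W(3))
    have "transpose_mat (W * V) * G * (W * V) = transpose_mat V * G1 * V"
      unfolding T G1_def using W(1) V VTc G by (simp add: assoc)
    thus "transpose_mat (W * V) * G * (W * V) = mat_diag ?n (case_nat e \<mu>2)" by (simp add: VGV)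
  qed
qed

section \<open>Decreasing enumerations and bases of right singular vectors\<close>

text \<open>Replaces the sorted list in \<open>kth_largest\<close> by a permutation of indices, so
  that sums over ranks can be reindexed. Ranks count from 1 and indices from 0, hence the shift
  \<open>j + 1\<close>.\<close>

lemma mset_real_enumeration:
  fixes f :: "nat \<Rightarrow> real"
  obtains \<pi> where "\<pi> permutes {..<d}"
    "\<And>j. j < d \<Longrightarrow> kth_largest (image_mset f (mset_set {..<d})) (j + 1) = f (\<pi> j)"
    "\<And>i j. i \<le> j \<Longrightarrow> j < d \<Longrightarrow> f (\<pi> j) \<le> f (\<pi> i)"
proof -
  define M where "M = image_mset f (mset_set {..<d})"
  define xs where "xs = rev (sorted_list_of_multiset M)"
  have "mset xs = mset (map f [0..<d])"
    by (simp add: xs_def M_def mset_set_upto_eq_mset_upto)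
  then obtain \<pi> where \<pi>: "\<pi> permutes {..<d}" "permute_list \<pi> (map f [0..<d]) = xs"
    by (metis mset_eq_permutation length_map length_upt diff_zero)
  have len: "length xs = d" using \<pi>(2) by (metis length_map length_permute_list length_upt diff_zero)
  have nth: "xs ! j = f (\<pi> j)" if "j < d" for j
  proof -
    have "\<pi> j < d" using permutes_in_image[OF \<pi>(1), of j] that by simp
    thus ?thesis using that \<pi> by (simp flip: \<pi>(2) add: permute_list_nth)
  qed
  have srt: "sorted (rev xs)" by (simp add: xs_def)
  show ?thesis
  proof (rule that[OF \<pi>(1)])
    show "kth_largest (image_mset f (mset_set {..<d})) (j + 1) = f (\<pi> j)" if "j < d" for j
      using nth[OF that] by (simp add: kth_largest_def xs_def M_def)
    show "f (\<pi> j) \<le> f (\<pi> i)" if "i \<le> j" "j < d" for i j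
      using sorted_rev_nth_mono[OF srt, of i j] that nth len by simp
  qed
qed


text \<open>Matrices and vectors become bare index functions here: the estimates are finite sums,
  and no carrier conditions have to be carried along.\<close>

definition mat_apply :: "nat \<Rightarrow> (nat \<Rightarrow> nat \<Rightarrow> real) \<Rightarrow> (nat \<Rightarrow> real) \<Rightarrow> nat \<Rightarrow> real" where
  "mat_apply d a u i = (\<Sum>j<d. a i j * u j)"

text \<open>The first clause is orthonormality of the vectors \<open>u a\<close>, the second is
  completeness. Stating both makes Parseval immediate and the notion symmetric under exchange of the
  two indices.\<close>

definition orthonormal_basis :: "nat \<Rightarrow> (nat \<Rightarrow> nat \<Rightarrow> real) \<Rightarrow> bool" where
  "orthonormal_basis d u \<longleftrightarrow>
     (\<forall>a<d. \<forall>b<d. (\<Sum>i<d. u a i * u b i) = (if a = b then 1 else 0)) \<and>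
     (\<forall>i<d. \<forall>j<d. (\<Sum>a<d. u a i * u a j) = (if i = j then 1 else 0))"

text \<open>Links singular values, defined by roots counted with multiplicity, to the spectral
  theorem: similar matrices share the characteristic polynomial, and that of a diagonal matrix is a
  product of linear factors.\<close>

lemma proots_char_poly_similar_diag:
  fixes G :: "real mat"
  assumes G: "G \<in> carrier_mat d d" and U: "U \<in> carrier_mat d d" "transpose_mat U * U = 1\<^sub>m d"
    and diag: "transpose_mat U * G * U = mat_diag d \<mu>"
  shows "proots (char_poly G) = image_mset \<mu> (mset_set {..<d})"
proof -
  have UU: "U * transpose_mat U = 1\<^sub>m d"
    using mat_mult_left_right_inverse[OF _ U(1) U(2)] U(1) by simp
  have "similar_mat (mat_diag d \<mu>) G"
    by (rule similar_matI[of _ _ "transpose_mat U" U d]) (use G U UU diag in auto)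
  hence "char_poly G = char_poly (mat_diag d \<mu>)" by (simp add: char_poly_similar)
  also have "\<dots> = (\<Prod>a\<leftarrow>diag_mat (mat_diag d \<mu>). [:- a, 1:])"
    by (rule char_poly_upper_triangular) (auto simp: mat_diag_def)
  also have "diag_mat (mat_diag d \<mu>) = map \<mu> [0..<d]"
    by (auto simp: diag_mat_def mat_diag_def intro!: nth_equalityI)
  also have "(\<Prod>a\<leftarrow>map \<mu> [0..<d]. [:- a, 1:]) = (\<Prod>p\<leftarrow>map (\<lambda>i. [:- \<mu> i, 1:]) [0..<d]. p)"
    by (simp add: comp_def)
  finally have "proots (char_poly G) = (\<Sum>p\<leftarrow>map (\<lambda>i. [:- \<mu> i, 1:]) [0..<d]. proots p)"
    by (simp only:) (rule proots_prod_list, auto)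
  also have "\<dots> = mset (map \<mu> [0..<d])"
    by (induction d) auto
  finally show ?thesis by (simp add: mset_set_upto_eq_mset_upto)
qed

text \<open>The right singular vectors in decreasing order. The columns of \<open>A * U\<close> are
  orthogonal because U diagonalises the Gram matrix, and their squared norms are its eigenvalues,
  which are thus nonnegative; \<open>\<pi>\<close> sorts them.\<close>

lemma singular_basis:
  assumes A: "A \<in> carrier_mat n d"
  obtains u where "orthonormal_basis d u"
    "\<And>a b. a < d \<Longrightarrow> b < d \<Longrightarrow>
       (\<Sum>i<n. mat_apply d (\<lambda>i j. A $$ (i, j)) (u a) i * mat_apply d (\<lambda>i j. A $$ (i, j)) (u b) i)
       = (if a = b then (singular_value A (a + 1))\<^sup>2 else 0)"
    "\<And>a. a < d \<Longrightarrow> 0 \<le> singular_value A (a + 1)"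
    "\<And>a b. a \<le> b \<Longrightarrow> b < d \<Longrightarrow> singular_value A (b + 1) \<le> singular_value A (a + 1)"
proof -
  define G where "G = transpose_mat A * A"
  have G: "G \<in> carrier_mat d d" "transpose_mat G = G"
    using A by (auto simp: G_def transpose_mult[of _ d n])
  obtain U \<mu> where U: "U \<in> carrier_mat d d" "transpose_mat U * U = 1\<^sub>m d"
    and diag: "transpose_mat U * G * U = mat_diag d \<mu>"
    using symmetric_mat_spectral[OF G] by blast
  have UU: "U * transpose_mat U = 1\<^sub>m d"
    using mat_mult_left_right_inverse[OF _ U(1) U(2)] U(1) by simp
  have "transpose_mat U * G * U = transpose_mat (A * U) * (A * U)"
    using A U by (simp add: G_def transpose_mult[of _ n d] assoc_mult_mat[of _ d n _ d _ d]
        assoc_mult_mat[of _ d d _ n _ d] assoc_mult_mat[of _ d d _ d _ d])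
  hence AU: "(A * U) \<in> carrier_mat n d" "transpose_mat (A * U) * (A * U) = mat_diag d \<mu>"
    using A U diag by auto
  have gram: "(\<Sum>i<n. (A * U) $$ (i, a) * (A * U) $$ (i, b)) = (if a = b then \<mu> b else 0)"
    if "a < d" "b < d" for a b
    using arg_cong[OF AU(2), of "\<lambda>M. M $$ (a, b)"] that A U
    by (simp add: scalar_prod_def mat_diag_def lessThan_atLeast0)
  have \<mu>0: "0 \<le> \<mu> a" if "a < d" for a
    using gram[OF that that] by (metis (mono_tags, lifting) sum_nonneg zero_le_square)
  have sv: "singular_value A = kth_largest (image_mset (\<lambda>a. sqrt (\<mu> a)) (mset_set {..<d}))"
    unfolding singular_value_def G_def[symmetric] proots_char_poly_similar_diag[OF G(1) U diag]
    by (simp add: image_mset.compositionality comp_def)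
  obtain \<pi> where \<pi>: "\<pi> permutes {..<d}"
    "\<And>j. j < d \<Longrightarrow> singular_value A (j + 1) = sqrt (\<mu> (\<pi> j))"
    "\<And>i j. i \<le> j \<Longrightarrow> j < d \<Longrightarrow> sqrt (\<mu> (\<pi> j)) \<le> sqrt (\<mu> (\<pi> i))"
    unfolding sv by (rule mset_real_enumeration[of d "\<lambda>a. sqrt (\<mu> a)"]) blast
  have \<pi>d: "\<pi> a < d" if "a < d" for a using permutes_in_image[OF \<pi>(1), of a] that by simp
  have \<pi>inj: "\<pi> a = \<pi> b \<longleftrightarrow> a = b" for a b using permutes_inj[OF \<pi>(1)] by (auto dest: injD)
  show ?thesis
  proof (rule that[of "\<lambda>a i. U $$ (i, \<pi> a)"])
    show "orthonormal_basis d (\<lambda>a i. U $$ (i, \<pi> a))"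
      unfolding orthonormal_basis_def
    proof (intro conjI allI impI)
      fix a b assume "a < d" "b < d"
      thus "(\<Sum>i<d. U $$ (i, \<pi> a) * U $$ (i, \<pi> b)) = (if a = b then 1 else 0)"
        using arg_cong[OF U(2), of "\<lambda>M. M $$ (\<pi> a, \<pi> b)"] U(1) \<pi>d \<pi>inj
        by (simp add: scalar_prod_def lessThan_atLeast0)
    next
      fix i j assume ij: "i < d" "j < d"
      have "(\<Sum>a<d. U $$ (i, \<pi> a) * U $$ (j, \<pi> a)) = (\<Sum>a<d. U $$ (i, a) * U $$ (j, a))"
        using sum.permute[OF \<pi>(1), of "\<lambda>a. U $$ (i, a) * U $$ (j, a)"] by (simp add: comp_def)
      also have "\<dots> = (if i = j then 1 else 0)"
        using arg_cong[OF UU, of "\<lambda>M. M $$ (i, j)"] U(1) ij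
        by (simp add: scalar_prod_def lessThan_atLeast0)
      finally show "(\<Sum>a<d. U $$ (i, \<pi> a) * U $$ (j, \<pi> a)) = (if i = j then 1 else 0)" .
    qed
    show "(\<Sum>i<n. mat_apply d (\<lambda>i j. A $$ (i, j)) (\<lambda>i. U $$ (i, \<pi> a)) i *
        mat_apply d (\<lambda>i j. A $$ (i, j)) (\<lambda>i. U $$ (i, \<pi> b)) i)
       = (if a = b then (singular_value A (a + 1))\<^sup>2 else 0)" if ab: "a < d" "b < d" for a b
    proof -
      have *: "mat_apply d (\<lambda>i j. A $$ (i, j)) (\<lambda>i. U $$ (i, \<pi> c)) i = (A * U) $$ (i, \<pi> c)"
        if "c < d" "i < n" for c i
        using that A U(1) \<pi>d by (simp add: mat_apply_def scalar_prod_def lessThan_atLeast0)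
      show ?thesis
        using gram[OF \<pi>d[OF ab(1)] \<pi>d[OF ab(2)]] \<mu>0[OF \<pi>d[OF ab(2)]] \<pi>(2)[OF ab(2)] \<pi>inj ab
        by (simp add: *)
    qed
    show "0 \<le> singular_value A (a + 1)" if "a < d" for a
      using \<pi>(2)[OF that] \<mu>0[OF \<pi>d[OF that]] by simp
    show "singular_value A (b + 1) \<le> singular_value A (a + 1)" if "a \<le> b" "b < d" for a b
      using \<pi>(2)[of a] \<pi>(2)[of b] \<pi>(3)[of a b] that by simp
  qed
qed

subsection \<open>Block bounds for top-k energies\<close>

lemma sum_swap_outer:
  "(\<Sum>i\<in>A. \<Sum>b\<in>B. \<Sum>c\<in>C. f i b c) = (\<Sum>b\<in>B. \<Sum>c\<in>C. \<Sum>i\<in>A. f i b c)"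
proof -
  have "(\<Sum>i\<in>A. \<Sum>b\<in>B. \<Sum>c\<in>C. f i b c) = (\<Sum>b\<in>B. \<Sum>i\<in>A. \<Sum>c\<in>C. f i b c)"
    by (rule sum.swap)
  also have "\<dots> = (\<Sum>b\<in>B. \<Sum>c\<in>C. \<Sum>i\<in>A. f i b c)"
    by (intro sum.cong refl sum.swap)
  finally show ?thesis .
qed

text \<open>The sum over b of w_b w_b^T is the identity, so the forms of M at the vectors
  \<open>w b\<close> cut down to K add up to the trace of the block of M on K. Rank-one M gives
  Parseval, and the unit matrix counts dimensions.\<close>

lemma orthonormal_basis_trace:
  assumes w: "orthonormal_basis d w" and K: "K \<subseteq> {..<d}"
  shows "(\<Sum>b<d. \<Sum>a\<in>K. \<Sum>c\<in>K. w b a * M a c * w b c) = (\<Sum>a\<in>K. M a a)"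
proof -
  have fin: "finite K" using K finite_subset by blast
  have "(\<Sum>b<d. \<Sum>a\<in>K. \<Sum>c\<in>K. w b a * M a c * w b c)
      = (\<Sum>a\<in>K. \<Sum>c\<in>K. \<Sum>b<d. w b a * M a c * w b c)"
    by (rule sum_swap_outer)
  also have "\<dots> = (\<Sum>a\<in>K. \<Sum>c\<in>K. M a c * (\<Sum>b<d. w b a * w b c))"
    by (intro sum.cong refl) (simp add: sum_distrib_left mult_ac)
  also have "\<dots> = (\<Sum>a\<in>K. \<Sum>c\<in>K. if a = c then M a c else 0)"
    using w K by (intro sum.cong refl) (auto simp: orthonormal_basis_def subset_iff)
  also have "\<dots> = (\<Sum>a\<in>K. M a a)"
    using fin by (simp add: sum.delta)
  finally show ?thesis .
qed

lemma orthonormal_basis_transpose: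
  "orthonormal_basis d w \<Longrightarrow> orthonormal_basis d (\<lambda>a b. w b a)"
  by (simp add: orthonormal_basis_def)

lemma orthonormal_basis_parseval:
  assumes w: "orthonormal_basis d w" and K: "K \<subseteq> {..<d}"
  shows "(\<Sum>b<d. (\<Sum>a\<in>K. w b a * x a)\<^sup>2) = (\<Sum>a\<in>K. (x a)\<^sup>2)"
  using orthonormal_basis_trace[OF assms, of "\<lambda>a c. x a * x c"]
  by (simp add: power2_eq_square sum_product mult_ac)

text \<open>With M11 >= \<tau> and M22 <= \<tau> - \<delta>, the matrix M is dominated by the
  block-diagonal matrix with blocks M11 + M12 M12^T / \<delta> and \<tau> I. The first block is at
  least \<tau>, so k orthonormal vectors collect no more than its trace.\<close>

lemma block_trace_bound:
  fixes M w :: "nat \<Rightarrow> nat \<Rightarrow> real"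
  assumes w: "orthonormal_basis d w" and k: "k \<le> d"
    and sym: "\<And>a c. M a c = M c a" and \<delta>: "0 < \<delta>"
    and lower: "\<And>x. \<tau> * (\<Sum>a<k. (x a)\<^sup>2) \<le> (\<Sum>a<k. \<Sum>c<k. x a * M a c * x c)"
    and upper: "\<And>y. (\<Sum>a\<in>{k..<d}. \<Sum>c\<in>{k..<d}. y a * M a c * y c)
                   \<le> (\<tau> - \<delta>) * (\<Sum>a\<in>{k..<d}. (y a)\<^sup>2)"
  shows "(\<Sum>b<k. \<Sum>a<d. \<Sum>c<d. w b a * M a c * w b c)
    \<le> (\<Sum>a<k. M a a) + (\<Sum>a<k. \<Sum>c\<in>{k..<d}. (M a c)\<^sup>2) / \<delta>"
proof -
  let ?L = "{..<k}" and ?H = "{k..<d}"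
  have split: "{..<d} = ?L \<union> ?H" "?L \<inter> ?H = {}" using k by auto
  have split_sum: "(\<Sum>a<d. f a) = (\<Sum>a<k. f a) + (\<Sum>a\<in>?H. f a)" for f :: "nat \<Rightarrow> real"
    unfolding split(1) by (rule sum.union_disjoint) auto
  define X where "X b = (\<Sum>a<k. \<Sum>c<k. w b a * M a c * w b c)" for b
  define q where "q b c = (\<Sum>a<k. w b a * M a c)" for b c
  \<comment> \<open>\<open>N b\<close> is the form of the enlarged first block at the first k
    coordinates of \<open>w b\<close>.\<close>
  define N where "N b = X b + (\<Sum>c\<in>?H. (q b c)\<^sup>2) / \<delta>" for b
  define lx where "lx b = (\<Sum>a<k. (w b a)\<^sup>2)" for b
  define ly where "ly b = (\<Sum>a\<in>?H. (w b a)\<^sup>2)" for b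
  have each: "(\<Sum>a<d. \<Sum>c<d. w b a * M a c * w b c) \<le> N b + \<tau> * ly b" for b
  proof -
    have "(\<Sum>a<d. \<Sum>c<d. w b a * M a c * w b c)
        = X b + (\<Sum>a<k. \<Sum>c\<in>?H. w b a * M a c * w b c)
          + ((\<Sum>a\<in>?H. \<Sum>c<k. w b a * M a c * w b c) + (\<Sum>a\<in>?H. \<Sum>c\<in>?H. w b a * M a c * w b c))"
      by (simp add: split_sum X_def sum.distrib)
    also have "(\<Sum>a\<in>?H. \<Sum>c<k. w b a * M a c * w b c) = (\<Sum>c\<in>?H. q b c * w b c)"
      unfolding q_def sum_distrib_right by (intro sum.cong refl) (metis mult.commute mult.left_commute sym)
    also have "(\<Sum>a<k. \<Sum>c\<in>?H. w b a * M a c * w b c) = (\<Sum>c\<in>?H. q b c * w b c)"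
      unfolding q_def sum_distrib_right by (rule sum.swap)
    finally have eq: "(\<Sum>a<d. \<Sum>c<d. w b a * M a c * w b c)
        = X b + (\<Sum>c\<in>?H. 2 * (q b c * w b c)) + (\<Sum>a\<in>?H. \<Sum>c\<in>?H. w b a * M a c * w b c)"
      by (simp add: sum_distrib_left[symmetric])
    have amgm: "2 * (p * y) \<le> p\<^sup>2 / \<delta> + \<delta> * y\<^sup>2" for p y :: real
    proof -
      have "p\<^sup>2 / \<delta> + \<delta> * y\<^sup>2 - 2 * (p * y) = (p - \<delta> * y)\<^sup>2 / \<delta>"
        using \<delta> by (simp add: field_simps power2_eq_square)
      also have "\<dots> \<ge> 0" using \<delta> by simp
      finally show ?thesis by linarith
    qed
    have "(\<Sum>c\<in>?H. 2 * (q b c * w b c)) \<le> (\<Sum>c\<in>?H. (q b c)\<^sup>2 / \<delta> + \<delta> * (w b c)\<^sup>2)"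
      by (intro sum_mono amgm)
    also have "\<dots> = (\<Sum>c\<in>?H. (q b c)\<^sup>2) / \<delta> + \<delta> * ly b"
      by (simp add: sum.distrib ly_def sum_divide_distrib sum_distrib_left)
    finally show ?thesis
      using eq upper[of "w b"] by (simp add: N_def ly_def algebra_simps)
  qed
  have "(\<Sum>b<d. N b) = (\<Sum>a<k. M a a) + (\<Sum>c\<in>?H. \<Sum>b<d. (q b c)\<^sup>2) / \<delta>"
    unfolding N_def sum.distrib sum_divide_distrib[symmetric] X_def
    using orthonormal_basis_trace[OF w, of "?L" M] k by (subst sum.swap[of _ ?H]) auto
  also have "(\<Sum>c\<in>?H. \<Sum>b<d. (q b c)\<^sup>2) = (\<Sum>c\<in>?H. \<Sum>a<k. (M a c)\<^sup>2)"
    unfolding q_def using k by (intro sum.cong refl orthonormal_basis_parseval w) auto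
  also have "\<dots> = (\<Sum>a<k. \<Sum>c\<in>?H. (M a c)\<^sup>2)" by (rule sum.swap)
  finally have total: "(\<Sum>b<k. N b) + (\<Sum>b\<in>?H. N b)
      = (\<Sum>a<k. M a a) + (\<Sum>a<k. \<Sum>c\<in>?H. (M a c)\<^sup>2) / \<delta>"
    by (simp add: split_sum)
  have rest: "(\<Sum>b\<in>?H. N b) \<ge> \<tau> * (\<Sum>b\<in>?H. lx b)"
    unfolding sum_distrib_left
  proof (rule sum_mono)
    fix b
    have "0 \<le> (\<Sum>c\<in>?H. (q b c)\<^sup>2) / \<delta>" using \<delta> by (intro divide_nonneg_pos sum_nonneg) auto
    thus "\<tau> * lx b \<le> N b" using lower[of "w b"] by (simp add: N_def X_def lx_def)
  qed
  \<comment> \<open>Mass balance: the first k coordinates carry total mass k over all vectors, and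
    the first k vectors carry total mass k over all coordinates. So what the first k vectors place
    on the second block equals what the other vectors place on the first.\<close>
  have "(\<Sum>b<d. lx b) = real k"
    using orthonormal_basis_trace[OF w, of ?L "\<lambda>a c. if a = c then 1 else 0"] k
    by (simp add: lx_def power2_eq_square sum.delta if_distrib[of "\<lambda>x. _ * x"] if_distrib[of "\<lambda>x. x * _"] cong: if_cong)
  moreover have "(\<Sum>b<k. lx b + ly b) = real k"
  proof -
    have "lx b + ly b = 1" if "b < k" for b
    proof -
      have "lx b + ly b = (\<Sum>a<d. (w b a)\<^sup>2)" by (simp add: split_sum lx_def ly_def)
      also have "\<dots> = 1" using w that k by (simp add: orthonormal_basis_def power2_eq_square)
      finally show ?thesis .
    qed
    thus ?thesis by simp
  qed
  ultimately have bal: "(\<Sum>b\<in>?H. lx b) = (\<Sum>b<k. ly b)"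
    by (simp add: split_sum sum.distrib)
  have "(\<Sum>b<k. \<Sum>a<d. \<Sum>c<d. w b a * M a c * w b c) \<le> (\<Sum>b<k. N b + \<tau> * ly b)"
    by (intro sum_mono each)
  also have "\<dots> = (\<Sum>b<k. N b) + \<tau> * (\<Sum>b\<in>?H. lx b)"
    by (simp add: sum.distrib bal sum_distrib_left)
  also have "\<dots> \<le> (\<Sum>b<k. N b) + (\<Sum>b\<in>?H. N b)" using rest by simp
  finally show ?thesis unfolding total .
qed

text \<open>An exchange argument at the threshold t, the k-th largest value: the mass missing on the
  k largest values equals the mass placed on the others, and moving it up replaces values at most t
  by values at least t.\<close>

lemma weighted_sum_le_top_sum:
  fixes f p :: "nat \<Rightarrow> real"
  assumes p: "\<And>j. j < d \<Longrightarrow> 0 \<le> p j" "\<And>j. j < d \<Longrightarrow> p j \<le> 1" "(\<Sum>j<d. p j) = real k"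
    and k: "1 \<le> k" "k \<le> d"
  shows "(\<Sum>j<d. f j * p j) \<le> (\<Sum>j = 1..k. kth_largest (image_mset f (mset_set {..<d})) j)"
proof -
  let ?H = "{k..<d}"
  obtain \<pi> where \<pi>: "\<pi> permutes {..<d}"
    "\<And>j. j < d \<Longrightarrow> kth_largest (image_mset f (mset_set {..<d})) (j + 1) = f (\<pi> j)"
    "\<And>i j. i \<le> j \<Longrightarrow> j < d \<Longrightarrow> f (\<pi> j) \<le> f (\<pi> i)"
    by (rule mset_real_enumeration[of d f]) blast
  have \<pi>d: "\<pi> a < d" if "a < d" for a using permutes_in_image[OF \<pi>(1), of a] that by simp
  have split_sum: "(\<Sum>a<d. g a) = (\<Sum>a<k. g a) + (\<Sum>a\<in>?H. g a)" for g :: "nat \<Rightarrow> real"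
    using k by (subst sum.union_disjoint[symmetric]) (auto intro!: sum.cong)
  define t where "t = f (\<pi> (k - 1))"
  have "(\<Sum>j<d. p (\<pi> j)) = real k"
    using sum.permute[OF \<pi>(1), of p] p(3) by (simp add: comp_def)
  hence bal: "(\<Sum>j<k. 1 - p (\<pi> j)) = (\<Sum>j\<in>?H. p (\<pi> j))"
    by (simp add: split_sum sum_subtractf)
  have "(\<Sum>j<d. f j * p j) = (\<Sum>j<d. f (\<pi> j) * p (\<pi> j))"
    using sum.permute[OF \<pi>(1), of "\<lambda>j. f j * p j"] by (simp add: comp_def)
  also have "\<dots> = (\<Sum>j<k. f (\<pi> j)) - (\<Sum>j<k. f (\<pi> j) * (1 - p (\<pi> j))) + (\<Sum>j\<in>?H. f (\<pi> j) * p (\<pi> j))"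
    by (simp add: split_sum sum_subtractf[symmetric] algebra_simps)
  also have "(\<Sum>j\<in>?H. f (\<pi> j) * p (\<pi> j)) \<le> (\<Sum>j\<in>?H. t * p (\<pi> j))"
    using k \<pi>d p(1) by (intro sum_mono mult_right_mono) (auto simp: t_def intro!: \<pi>(3))
  also have "(\<Sum>j\<in>?H. t * p (\<pi> j)) = (\<Sum>j<k. t * (1 - p (\<pi> j)))"
    by (simp only: sum_distrib_left[symmetric] bal)
  also have "\<dots> \<le> (\<Sum>j<k. f (\<pi> j) * (1 - p (\<pi> j)))"
    using k \<pi>d p(2) by (intro sum_mono mult_right_mono) (auto simp: t_def intro!: \<pi>(3))
  finally have "(\<Sum>j<d. f j * p j) \<le> (\<Sum>j<k. f (\<pi> j))" by simp
  also have "\<dots> = (\<Sum>j<k. kth_largest (image_mset f (mset_set {..<d})) (j + 1))"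
    using k by (intro sum.cong refl) (simp add: \<pi>(2)[simplified])
  also have "\<dots> = (\<Sum>j = 1..k. kth_largest (image_mset f (mset_set {..<d})) j)"
    by (rule sum.reindex_bij_witness[of _ "\<lambda>j. j - 1" "\<lambda>j. j + 1"]) auto
  finally show ?thesis .
qed

section \<open>Gram matrix of a perturbed matrix in a fixed basis\<close>

text \<open>The operator norm is at most the Frobenius norm: Cauchy-Schwarz in each row, applied to
  the vector z combining the \<open>u a\<close> with coefficients \<open>x a\<close>, whose squared
  norm is that of x on K.\<close>

lemma sum_squares_mat_apply_le:
  assumes u: "orthonormal_basis d u" and K: "K \<subseteq> {..<d}"
  shows "(\<Sum>i<n. (\<Sum>a\<in>K. x a * mat_apply d e (u a) i)\<^sup>2)
    \<le> (\<Sum>i<n. \<Sum>j<d. (e i j)\<^sup>2) * (\<Sum>a\<in>K. (x a)\<^sup>2)"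
proof -
  define z where "z j = (\<Sum>a\<in>K. u a j * x a)" for j
  have z: "(\<Sum>j<d. (z j)\<^sup>2) = (\<Sum>a\<in>K. (x a)\<^sup>2)"
    unfolding z_def using orthonormal_basis_parseval[OF orthonormal_basis_transpose[OF u] K] .
  have "(\<Sum>a\<in>K. x a * mat_apply d e (u a) i) = (\<Sum>j<d. e i j * z j)" for i
    unfolding mat_apply_def z_def sum_distrib_left
    by (subst sum.swap) (simp add: mult_ac)
  moreover have "(\<Sum>j<d. e i j * z j)\<^sup>2 \<le> (\<Sum>j<d. (e i j)\<^sup>2) * (\<Sum>j<d. (z j)\<^sup>2)" for i
    by (rule Cauchy_Schwarz_ineq_sum)
  ultimately show ?thesis by (simp add: z sum_distrib_right sum_mono)
qed

lemma mat_apply_add: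
  "mat_apply d (\<lambda>i j. a i j + e i j) x i = mat_apply d a x i + mat_apply d e x i"
  by (simp add: mat_apply_def algebra_simps sum.distrib)

text \<open>Turns the sum of all squared singular values into the sum of squared entries, whose
  expectation is elementary.\<close>

lemma frobenius_orthonormal_basis:
  assumes "orthonormal_basis d w"
  shows "(\<Sum>b<d. \<Sum>i<n. (mat_apply d a (w b) i)\<^sup>2) = (\<Sum>i<n. \<Sum>j<d. (a i j)\<^sup>2)"
  unfolding mat_apply_def
  by (subst sum.swap)
     (use orthonormal_basis_parseval[OF assms, of "{..<d}"] in \<open>simp add: mult.commute\<close>)

text \<open>The change of basis by which energies along v become forms of the Gram matrix in the
  basis u.\<close>

lemma orthonormal_basis_coefficients:
  assumes u: "orthonormal_basis d u" and v: "orthonormal_basis d v"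
  defines "w \<equiv> \<lambda>b a. \<Sum>j<d. u a j * v b j"
  shows "orthonormal_basis d w" "\<And>b j. j < d \<Longrightarrow> v b j = (\<Sum>a<d. w b a * u a j)"
proof -
  \<comment> \<open>Parseval in polarised form, from the trace identity for the rank-one array
    \<open>x a * y c\<close>.\<close>
  have trip: "(\<Sum>a<d. (\<Sum>j<d. u a j * x j) * (\<Sum>j<d. u a j * y j)) = (\<Sum>j<d. x j * y j)"
    if u: "orthonormal_basis d u" for x y and u :: "nat \<Rightarrow> nat \<Rightarrow> real"
    using orthonormal_basis_trace[OF u, of "{..<d}" "\<lambda>a c. x a * y c"]
    by (simp add: sum_product mult_ac)
  show "orthonormal_basis d w"
    unfolding orthonormal_basis_def w_def
  proof (intro conjI allI impI)
    fix a b assume "a < d" "b < d"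
    thus "(\<Sum>i<d. (\<Sum>j<d. u i j * v a j) * (\<Sum>j<d. u i j * v b j)) = (if a = b then 1 else 0)"
      unfolding trip[OF u] using v by (simp add: orthonormal_basis_def)
  next
    fix a b assume "a < d" "b < d"
    moreover have "(\<Sum>i<d. (\<Sum>j<d. u a j * v i j) * (\<Sum>j<d. u b j * v i j)) = (\<Sum>j<d. u a j * u b j)"
      using trip[OF v, of "u a" "u b"] by (simp add: mult.commute)
    ultimately show "(\<Sum>i<d. (\<Sum>j<d. u a j * v i j) * (\<Sum>j<d. u b j * v i j)) = (if a = b then 1 else 0)"
      using u by (simp add: orthonormal_basis_def)
  qed
  fix b j assume j: "j < d"
  have "(\<Sum>a<d. w b a * u a j) = (\<Sum>l<d. \<Sum>a<d. v b l * (u a l * u a j))"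
    unfolding w_def sum_distrib_right by (subst sum.swap) (simp add: mult_ac)
  also have "\<dots> = (\<Sum>l<d. if l = j then v b l else 0)"
    using u j by (intro sum.cong refl)
      (simp add: sum_distrib_left[symmetric] orthonormal_basis_def)
  finally show "v b j = (\<Sum>a<d. w b a * u a j)" using j by (simp add: sum.delta)
qed

text \<open>Applies \<open>block_trace_bound\<close> to the Gram matrix M of the perturbed matrix in
  the basis u, with \<delta> = L / 4. The basis v, later the right singular vectors of one outcome,
  has left the right-hand side.\<close>

lemma perturbed_top_energy_le:
  fixes a e u v :: "nat \<Rightarrow> nat \<Rightarrow> real"
  assumes u: "orthonormal_basis d u" and v: "orthonormal_basis d v" and k: "k \<le> d"
    and gram: "\<And>b c. b < d \<Longrightarrow> c < d \<Longrightarrow>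
       (\<Sum>i<n. mat_apply d a (u b) i * mat_apply d a (u c) i) = (if b = c then \<mu> b else 0)"
    and L: "0 < L" "\<And>b. b < k \<Longrightarrow> L \<le> \<mu> b" "\<And>b. k \<le> b \<Longrightarrow> b < d \<Longrightarrow> \<mu> b \<le> L / 2"
    and e: "(\<Sum>i<n. \<Sum>j<d. (e i j)\<^sup>2) \<le> L / 4096"
  defines "f \<equiv> \<lambda>i j. a i j + e i j"
  shows "(\<Sum>b<k. \<Sum>i<n. (mat_apply d f (v b) i)\<^sup>2)
    \<le> (\<Sum>b<k. \<Sum>i<n. (mat_apply d f (u b) i)\<^sup>2)
      + 4 / L * (\<Sum>b<k. \<Sum>c\<in>{k..<d}. (\<Sum>i<n. mat_apply d f (u b) i * mat_apply d f (u c) i)\<^sup>2)"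
proof -
  define M where "M b c = (\<Sum>i<n. mat_apply d f (u b) i * mat_apply d f (u c) i)" for b c
  define w where "w = (\<lambda>b a. \<Sum>j<d. u a j * v b j)"
  have w: "orthonormal_basis d w" "\<And>b j. j < d \<Longrightarrow> v b j = (\<Sum>a<d. w b a * u a j)"
    unfolding w_def by (rule orthonormal_basis_coefficients[OF u v], assumption?)+
  have form: "(\<Sum>b\<in>K. \<Sum>c\<in>K. x b * M b c * x c) = (\<Sum>i<n. (\<Sum>b\<in>K. x b * mat_apply d f (u b) i)\<^sup>2)"
    for K and x :: "nat \<Rightarrow> real"
  proof -
    have "(\<Sum>i<n. (\<Sum>b\<in>K. x b * mat_apply d f (u b) i)\<^sup>2)
        = (\<Sum>i<n. \<Sum>b\<in>K. \<Sum>c\<in>K. x b * mat_apply d f (u b) i * (x c * mat_apply d f (u c) i))"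
      by (simp add: power2_eq_square sum_product)
    also have "\<dots> = (\<Sum>b\<in>K. \<Sum>c\<in>K. \<Sum>i<n. x b * mat_apply d f (u b) i * (x c * mat_apply d f (u c) i))"
      by (rule sum_swap_outer)
    finally show ?thesis unfolding M_def by (simp add: sum_distrib_left sum_distrib_right mult_ac)
  qed
  define P where "P K x i = (\<Sum>b\<in>K. x b * mat_apply d a (u b) i)" for K i and x :: "nat \<Rightarrow> real"
  define Q where "Q K x i = (\<Sum>b\<in>K. x b * mat_apply d e (u b) i)" for K i and x :: "nat \<Rightarrow> real"
  have PQ: "(\<Sum>b\<in>K. x b * mat_apply d f (u b) i) = P K x i + Q K x i" for K x i
    unfolding f_def P_def Q_def mat_apply_add by (simp add: distrib_left sum.distrib)
  have P: "(\<Sum>i<n. (P K x i)\<^sup>2) = (\<Sum>b\<in>K. \<mu> b * (x b)\<^sup>2)" if K: "K \<subseteq> {..<d}" for K x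
  proof -
    have "(\<Sum>i<n. (P K x i)\<^sup>2)
        = (\<Sum>i<n. \<Sum>b\<in>K. \<Sum>c\<in>K. x b * mat_apply d a (u b) i * (x c * mat_apply d a (u c) i))"
      by (simp add: P_def power2_eq_square sum_product)
    also have "\<dots> = (\<Sum>b\<in>K. \<Sum>c\<in>K. \<Sum>i<n. x b * mat_apply d a (u b) i * (x c * mat_apply d a (u c) i))"
      by (rule sum_swap_outer)
    also have "\<dots> = (\<Sum>b\<in>K. \<Sum>c\<in>K. x b * x c * (\<Sum>i<n. mat_apply d a (u b) i * mat_apply d a (u c) i))"
      by (simp add: sum_distrib_left mult_ac)
    also have "\<dots> = (\<Sum>b\<in>K. \<Sum>c\<in>K. if b = c then \<mu> b * (x b)\<^sup>2 else 0)"
      using K by (intro sum.cong refl) (auto simp: gram subset_iff power2_eq_square)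
    also have "\<dots> = (\<Sum>b\<in>K. \<mu> b * (x b)\<^sup>2)"
      using K finite_subset[OF K] by (simp add: sum.delta)
    finally show ?thesis .
  qed
  have Q: "(\<Sum>i<n. (Q K x i)\<^sup>2) \<le> L / 4096 * (\<Sum>b\<in>K. (x b)\<^sup>2)" if K: "K \<subseteq> {..<d}" for K x
    unfolding Q_def
    by (rule order_trans[OF sum_squares_mat_apply_le[OF u K] mult_right_mono[OF e]]) (simp add: sum_nonneg)
  have bound: "(\<Sum>b<k. \<Sum>a<d. \<Sum>c<d. w b a * M a c * w b c)
    \<le> (\<Sum>a<k. M a a) + (\<Sum>a<k. \<Sum>c\<in>{k..<d}. (M a c)\<^sup>2) / (L / 4)"
  \<comment> \<open>The lower estimate keeps 15/16 of L and loses 15 times L / 4096, which is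
    \<tau>, about 0.93 L. The upper estimate gives 17/16 of L / 2 plus 17 times L / 4096, about 0.54
    L, so the blocks are more than L / 4 apart.\<close>
  proof (rule block_trace_bound[OF w(1) k, where \<tau> = "15 * L / 16 - 15 * L / 4096"])
    show "M a c = M c a" for a c by (simp add: M_def mult.commute)
    show "0 < L / 4" using L by simp
    show "(15 * L / 16 - 15 * L / 4096) * (\<Sum>a<k. (x a)\<^sup>2) \<le> (\<Sum>a<k. \<Sum>c<k. x a * M a c * x c)" for x
    proof -
      have K: "{..<k} \<subseteq> {..<d}" using k by auto
      \<comment> \<open>Young's inequality for the product 2 p q with weights 1/16 and 16; the small
        weight goes to the large part P.\<close>
      have "15 / 16 * p\<^sup>2 - 15 * q\<^sup>2 \<le> (p + q)\<^sup>2" for p q :: real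
        using zero_le_power2[of "p / 4 + 4 * q"] by (simp add: power2_eq_square field_simps)
      hence "(\<Sum>i<n. 15 / 16 * (P {..<k} x i)\<^sup>2 - 15 * (Q {..<k} x i)\<^sup>2)
          \<le> (\<Sum>i<n. (P {..<k} x i + Q {..<k} x i)\<^sup>2)"
        by (intro sum_mono)
      hence "15 / 16 * (\<Sum>i<n. (P {..<k} x i)\<^sup>2) - 15 * (\<Sum>i<n. (Q {..<k} x i)\<^sup>2)
          \<le> (\<Sum>a<k. \<Sum>c<k. x a * M a c * x c)"
        by (simp add: form PQ sum_subtractf sum_distrib_left)
      moreover have "L * (\<Sum>a<k. (x a)\<^sup>2) \<le> (\<Sum>i<n. (P {..<k} x i)\<^sup>2)"
        unfolding P[OF K] sum_distrib_left by (intro sum_mono mult_right_mono L) auto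
      ultimately show ?thesis using Q[OF K, of x] by (simp add: algebra_simps)
    qed
    show "(\<Sum>a\<in>{k..<d}. \<Sum>c\<in>{k..<d}. y a * M a c * y c)
        \<le> (15 * L / 16 - 15 * L / 4096 - L / 4) * (\<Sum>a\<in>{k..<d}. (y a)\<^sup>2)" for y
    proof -
      let ?K = "{k..<d}"
      have K: "?K \<subseteq> {..<d}" by auto
      have "(p + q)\<^sup>2 \<le> 17 / 16 * p\<^sup>2 + 17 * q\<^sup>2" for p q :: real
        using zero_le_power2[of "p / 4 - 4 * q"] by (simp add: power2_eq_square field_simps)
      hence "(\<Sum>i<n. (P ?K y i + Q ?K y i)\<^sup>2) \<le> (\<Sum>i<n. 17 / 16 * (P ?K y i)\<^sup>2 + 17 * (Q ?K y i)\<^sup>2)"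
        by (intro sum_mono)
      hence "(\<Sum>a\<in>?K. \<Sum>c\<in>?K. y a * M a c * y c)
          \<le> 17 / 16 * (\<Sum>i<n. (P ?K y i)\<^sup>2) + 17 * (\<Sum>i<n. (Q ?K y i)\<^sup>2)"
        by (simp add: form PQ sum.distrib sum_distrib_left)
      moreover have "(\<Sum>i<n. (P ?K y i)\<^sup>2) \<le> L / 2 * (\<Sum>a\<in>?K. (y a)\<^sup>2)"
        unfolding P[OF K] sum_distrib_left by (intro sum_mono mult_right_mono L) auto
      ultimately have "(\<Sum>a\<in>?K. \<Sum>c\<in>?K. y a * M a c * y c)
          \<le> (17 * L / 32 + 17 * L / 4096) * (\<Sum>a\<in>?K. (y a)\<^sup>2)"
        using Q[OF K, of y] by (simp add: algebra_simps)
      also have "\<dots> \<le> (15 * L / 16 - 15 * L / 4096 - L / 4) * (\<Sum>a\<in>?K. (y a)\<^sup>2)"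
        using L(1) by (intro mult_right_mono sum_nonneg) auto
      finally show ?thesis .
    qed
  qed
  have forms: "(\<Sum>a<d. \<Sum>c<d. w b a * M a c * w b c) = (\<Sum>i<n. (mat_apply d f (v b) i)\<^sup>2)" for b
  proof -
    have "(\<Sum>a<d. w b a * mat_apply d f (u a) i) = mat_apply d f (v b) i" for i
    proof -
      have "(\<Sum>a<d. w b a * mat_apply d f (u a) i) = (\<Sum>j<d. f i j * (\<Sum>a<d. w b a * u a j))"
        unfolding mat_apply_def sum_distrib_left by (subst sum.swap) (simp add: mult_ac)
      also have "\<dots> = (\<Sum>j<d. f i j * v b j)"
        by (intro sum.cong refl) (simp add: w(2))
      finally show ?thesis by (simp add: mat_apply_def)
    qed
    thus ?thesis by (simp add: form)
  qed
  have traces: "M b b = (\<Sum>i<n. (mat_apply d f (u b) i)\<^sup>2)" for b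
    by (simp add: M_def power2_eq_square)
  have quarter: "c / (L / 4) = 4 / L * c" for c by simp
  show ?thesis using bound unfolding forms traces quarter unfolding M_def .
qed

subsection \<open>Moments of independent noise\<close>

text \<open>Pythagoras in L^2. The condition concerns products
  \<open>Z s \<omega> * Z t \<omega>\<close>, so it serves for single noise entries and for products
  of two entries alike.\<close>

lemma expectation_square_uncorrelated:
  fixes Z :: "'s \<Rightarrow> 'a \<Rightarrow> real"
  assumes fin: "finite (set_pmf P)" and S: "finite S"
    and orth: "\<And>s t. s \<in> S \<Longrightarrow> t \<in> S \<Longrightarrow> s \<noteq> t \<Longrightarrow> measure_pmf.expectation P (\<lambda>\<omega>. Z s \<omega> * Z t \<omega>) = 0"
  shows "measure_pmf.expectation P (\<lambda>\<omega>. (\<Sum>s\<in>S. c s * Z s \<omega>)\<^sup>2)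
    = (\<Sum>s\<in>S. (c s)\<^sup>2 * measure_pmf.expectation P (\<lambda>\<omega>. (Z s \<omega>)\<^sup>2))"
proof -
  note int = integrable_measure_pmf_finite[OF fin]
  have "measure_pmf.expectation P (\<lambda>\<omega>. (\<Sum>s\<in>S. c s * Z s \<omega>)\<^sup>2)
      = measure_pmf.expectation P (\<lambda>\<omega>. \<Sum>s\<in>S. \<Sum>t\<in>S. (c s * c t) * (Z s \<omega> * Z t \<omega>))"
    by (simp add: power2_eq_square sum_product mult_ac)
  also have "\<dots> = (\<Sum>s\<in>S. \<Sum>t\<in>S. (c s * c t) * measure_pmf.expectation P (\<lambda>\<omega>. Z s \<omega> * Z t \<omega>))"
    by (simp add: int)
  also have "\<dots> = (\<Sum>s\<in>S. \<Sum>t\<in>S. if s = t then (c s)\<^sup>2 * measure_pmf.expectation P (\<lambda>\<omega>. (Z s \<omega>)\<^sup>2) else 0)"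
    by (intro sum.cong refl) (auto simp: orth power2_eq_square)
  finally show ?thesis using S by (simp add: sum.delta)
qed

lemma expectation_pair_pmf_times:
  fixes h :: "'a \<Rightarrow> real" and F :: "'b \<Rightarrow> real"
  assumes "finite (set_pmf p)" "finite (set_pmf q)"
  shows "measure_pmf.expectation (pair_pmf p q) (\<lambda>z. h (fst z) * F (snd z))
    = measure_pmf.expectation p h * measure_pmf.expectation q F"
proof -
  have "measure_pmf.expectation (pair_pmf p q) (\<lambda>z. h (fst z) * F (snd z))
      = (\<Sum>z\<in>set_pmf p \<times> set_pmf q. h (fst z) * F (snd z) * pmf (pair_pmf p q) z)"
    using assms by (intro integral_measure_pmf_real) auto
  also have "\<dots> = (\<Sum>a\<in>set_pmf p. \<Sum>b\<in>set_pmf q. (h a * pmf p a) * (F b * pmf q b))"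
    by (subst sum.cartesian_product) (auto simp: pmf_pair mult_ac intro!: sum.cong)
  also have "\<dots> = (\<Sum>a\<in>set_pmf p. h a * pmf p a) * (\<Sum>b\<in>set_pmf q. F b * pmf q b)"
    by (simp add: sum_product)
  also have "\<dots> = measure_pmf.expectation p h * measure_pmf.expectation q F"
    using assms by (simp add: integral_measure_pmf_real[of "set_pmf p"] integral_measure_pmf_real[of "set_pmf q"])
  finally show ?thesis .
qed

text \<open>Independence of one coordinate from the rest. That F ignores coordinate x is expressed
  by invariance under \<open>fun_upd\<close>; on the right, F is averaged with that coordinate
  frozen at \<open>dflt\<close>.\<close>

lemma expectation_Pi_pmf_component_times:
  fixes h :: "'b \<Rightarrow> real" and F :: "('a \<Rightarrow> 'b) \<Rightarrow> real"
  assumes I: "finite I" "x \<in> I" and q: "\<And>x. x \<in> I \<Longrightarrow> finite (set_pmf (q x))"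
    and F: "\<And>\<omega> y. F (fun_upd \<omega> x y) = F \<omega>"
  shows "measure_pmf.expectation (Pi_pmf I dflt q) (\<lambda>\<omega>. h (\<omega> x) * F \<omega>)
    = measure_pmf.expectation (q x) h * measure_pmf.expectation (Pi_pmf (I - {x}) dflt q) F"
proof -
  let ?P = "Pi_pmf (I - {x}) dflt q"
  have ins: "insert x (I - {x}) = I" using I by auto
  have P: "Pi_pmf I dflt q = map_pmf (\<lambda>(y, f). fun_upd f x y) (pair_pmf (q x) ?P)"
    using Pi_pmf_insert[of "I - {x}" x dflt q] I unfolding ins by simp
  have "finite (set_pmf ?P)"
    using I q by (auto simp: set_Pi_pmf)
  thus ?thesis
    using expectation_pair_pmf_times[of "q x" ?P h F] I q
    by (simp add: P F case_prod_beta)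
qed

section \<open>Second and fourth moments of a bounded, centred noise matrix\<close>

text \<open>What the moment bounds use about the law of a single entry. Finite support makes every
  real function integrable, and the deviation bound r controls all moments.\<close>

locale matrix_noise =
  fixes n d :: nat and q :: "nat \<times> nat \<Rightarrow> real pmf" and a :: "nat \<Rightarrow> nat \<Rightarrow> real" and r :: real
  assumes finite_support: "\<And>i j. i < n \<Longrightarrow> j < d \<Longrightarrow> finite (set_pmf (q (i, j)))"
    and mean: "\<And>i j. i < n \<Longrightarrow> j < d \<Longrightarrow> measure_pmf.expectation (q (i, j)) (\<lambda>y. y) = a i j"
    and bound: "\<And>i j y. i < n \<Longrightarrow> j < d \<Longrightarrow> y \<in> set_pmf (q (i, j)) \<Longrightarrow> \<bar>y - a i j\<bar> \<le> r"
begin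

definition law :: "(nat \<times> nat \<Rightarrow> real) pmf" where
  "law = Pi_pmf ({..<n} \<times> {..<d}) 0 q"

definition e :: "(nat \<times> nat \<Rightarrow> real) \<Rightarrow> nat \<Rightarrow> nat \<Rightarrow> real" where
  "e \<omega> i j = \<omega> (i, j) - a i j"

abbreviation Ex :: "((nat \<times> nat \<Rightarrow> real) \<Rightarrow> real) \<Rightarrow> real" where
  "Ex \<equiv> measure_pmf.expectation law"

lemma finite_law: "finite (set_pmf law)"
  unfolding law_def using finite_support by (subst set_Pi_pmf) auto

lemma integrable_law [simp]: "integrable (measure_pmf law) (f :: _ \<Rightarrow> real)"
  by (rule integrable_measure_pmf_finite[OF finite_law])

lemma Ex_mono: "(\<And>\<omega>. \<omega> \<in> set_pmf law \<Longrightarrow> f \<omega> \<le> g \<omega>) \<Longrightarrow> Ex f \<le> Ex g"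
  by (rule integral_mono_AE) (auto intro: AE_pmfI)

lemma e_bound: "\<omega> \<in> set_pmf law \<Longrightarrow> i < n \<Longrightarrow> j < d \<Longrightarrow> \<bar>e \<omega> i j\<bar> \<le> r"
  unfolding law_def e_def
  by (subst (asm) set_Pi_pmf) (auto simp: PiE_dflt_def intro!: bound)

lemma e_square_bound: "\<omega> \<in> set_pmf law \<Longrightarrow> i < n \<Longrightarrow> j < d \<Longrightarrow> (e \<omega> i j)\<^sup>2 \<le> r\<^sup>2"
  using e_bound[of \<omega> i j] by (metis abs_ge_zero power2_abs power_mono)

text \<open>An entry occurring as a single linear factor annihilates the expectation, being centred
  and independent of the rest. Every cancellation below comes down to this.\<close>

lemma Ex_e_times:
  assumes ij: "i < n" "j < d" and F: "\<And>\<omega> y. F (fun_upd \<omega> (i, j) y) = F \<omega>"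
  shows "Ex (\<lambda>\<omega>. e \<omega> i j * F \<omega>) = 0"
proof -
  have "measure_pmf.expectation (q (i, j)) (\<lambda>y. y - a i j) = 0"
    using ij by (simp add: mean integrable_measure_pmf_finite finite_support)
  moreover have "Ex (\<lambda>\<omega>. e \<omega> i j * F \<omega>)
      = measure_pmf.expectation (q (i, j)) (\<lambda>y. y - a i j)
        * measure_pmf.expectation (Pi_pmf ({..<n} \<times> {..<d} - {(i, j)}) 0 q) F"
    unfolding law_def e_def
    by (rule expectation_Pi_pmf_component_times) (use ij F finite_support in auto)
  ultimately show ?thesis by simp
qed

lemma Ex_e [simp]: "i < n \<Longrightarrow> j < d \<Longrightarrow> Ex (\<lambda>\<omega>. e \<omega> i j) = 0"
  using Ex_e_times[of i j "\<lambda>_. 1"] by simp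

lemma Ex_e_e:
  "i < n \<Longrightarrow> j < d \<Longrightarrow> (i, j) \<noteq> (i', j') \<Longrightarrow> Ex (\<lambda>\<omega>. e \<omega> i j * e \<omega> i' j') = 0"
  by (rule Ex_e_times) (auto simp: e_def)

lemma Ex_e_square_le: "i < n \<Longrightarrow> j < d \<Longrightarrow> Ex (\<lambda>\<omega>. (e \<omega> i j)\<^sup>2) \<le> r\<^sup>2"
  using Ex_mono[of "\<lambda>\<omega>. (e \<omega> i j)\<^sup>2" "\<lambda>_. r\<^sup>2"] e_square_bound by simp

text \<open>x^T E y is a combination of uncorrelated entries with coefficients x_i y_j. Used for the
  terms of the Gram matrix that are linear in E.\<close>

lemma Ex_bilinear_square_le:
  "Ex (\<lambda>\<omega>. (\<Sum>i<n. x i * mat_apply d (e \<omega>) y i)\<^sup>2) \<le> r\<^sup>2 * (\<Sum>i<n. (x i)\<^sup>2) * (\<Sum>j<d. (y j)\<^sup>2)"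
proof -
  let ?I = "{..<n} \<times> {..<d}"
  have "Ex (\<lambda>\<omega>. (\<Sum>i<n. x i * mat_apply d (e \<omega>) y i)\<^sup>2)
      = Ex (\<lambda>\<omega>. (\<Sum>s\<in>?I. (x (fst s) * y (snd s)) * e \<omega> (fst s) (snd s))\<^sup>2)"
    unfolding mat_apply_def sum_distrib_left
    by (simp add: sum.cartesian_product case_prod_beta mult_ac)
  also have "\<dots> = (\<Sum>s\<in>?I. (x (fst s) * y (snd s))\<^sup>2 * Ex (\<lambda>\<omega>. (e \<omega> (fst s) (snd s))\<^sup>2))"
    by (rule expectation_square_uncorrelated[OF finite_law]) (auto intro!: Ex_e_e)
  also have "\<dots> \<le> (\<Sum>s\<in>?I. (x (fst s) * y (snd s))\<^sup>2 * r\<^sup>2)"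
    by (intro sum_mono mult_left_mono) (auto intro!: Ex_e_square_le)
  also have "\<dots> = (\<Sum>i<n. \<Sum>j<d. r\<^sup>2 * (x i)\<^sup>2 * (y j)\<^sup>2)"
    by (simp add: sum.cartesian_product case_prod_beta power_mult_distrib mult_ac)
  also have "\<dots> = r\<^sup>2 * ((\<Sum>i<n. (x i)\<^sup>2) * (\<Sum>j<d. (y j)\<^sup>2))"
    by (subst sum_product) (simp only: sum_distrib_left mult.assoc)
  finally show ?thesis by (simp only: mult.assoc)
qed

text \<open>The expectation of E^T E is the diagonal matrix of column variances, so a fixed
  direction y gains these variances weighted by the squares of its coordinates.\<close>

lemma Ex_column_energy:
  "Ex (\<lambda>\<omega>. \<Sum>i<n. (mat_apply d (\<lambda>i j. a i j + e \<omega> i j) y i)\<^sup>2)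
    = (\<Sum>i<n. (mat_apply d a y i)\<^sup>2) + (\<Sum>j<d. (\<Sum>i<n. Ex (\<lambda>\<omega>. (e \<omega> i j)\<^sup>2)) * (y j)\<^sup>2)"
proof -
  have row: "Ex (\<lambda>\<omega>. (mat_apply d (\<lambda>i j. a i j + e \<omega> i j) y i)\<^sup>2)
      = (mat_apply d a y i)\<^sup>2 + (\<Sum>j<d. (y j)\<^sup>2 * Ex (\<lambda>\<omega>. (e \<omega> i j)\<^sup>2))" if i: "i < n" for i
  proof -
    have "Ex (\<lambda>\<omega>. (mat_apply d (\<lambda>i j. a i j + e \<omega> i j) y i)\<^sup>2)
        = Ex (\<lambda>\<omega>. (mat_apply d a y i)\<^sup>2 + 2 * mat_apply d a y i * mat_apply d (e \<omega>) y i
            + (mat_apply d (e \<omega>) y i)\<^sup>2)"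
      unfolding mat_apply_add by (simp add: power2_sum algebra_simps)
    also have "\<dots> = (mat_apply d a y i)\<^sup>2 + 2 * mat_apply d a y i * Ex (\<lambda>\<omega>. mat_apply d (e \<omega>) y i)
            + Ex (\<lambda>\<omega>. (mat_apply d (e \<omega>) y i)\<^sup>2)"
      by simp
    also have "Ex (\<lambda>\<omega>. mat_apply d (e \<omega>) y i) = 0"
      using i by (simp add: mat_apply_def)
    also have "Ex (\<lambda>\<omega>. (mat_apply d (e \<omega>) y i)\<^sup>2) = Ex (\<lambda>\<omega>. (\<Sum>j<d. y j * e \<omega> i j)\<^sup>2)"
      by (simp add: mat_apply_def mult.commute)
    also have "\<dots> = (\<Sum>j<d. (y j)\<^sup>2 * Ex (\<lambda>\<omega>. (e \<omega> i j)\<^sup>2))"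
      by (rule expectation_square_uncorrelated[OF finite_law]) (use i in \<open>auto intro!: Ex_e_e\<close>)
    finally show ?thesis by simp
  qed
  have "Ex (\<lambda>\<omega>. \<Sum>i<n. (mat_apply d (\<lambda>i j. a i j + e \<omega> i j) y i)\<^sup>2)
      = (\<Sum>i<n. (mat_apply d a y i)\<^sup>2 + (\<Sum>j<d. (y j)\<^sup>2 * Ex (\<lambda>\<omega>. (e \<omega> i j)\<^sup>2)))"
    by (simp add: row)
  also have "\<dots> = (\<Sum>i<n. (mat_apply d a y i)\<^sup>2) + (\<Sum>j<d. \<Sum>i<n. (y j)\<^sup>2 * Ex (\<lambda>\<omega>. (e \<omega> i j)\<^sup>2))"
    by (simp add: sum.distrib) (rule sum.swap)
  finally show ?thesis by (simp add: sum_distrib_left sum_distrib_right mult_ac)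
qed

lemma Ex_frobenius:
  "Ex (\<lambda>\<omega>. \<Sum>i<n. \<Sum>j<d. (a i j + e \<omega> i j)\<^sup>2)
    = (\<Sum>i<n. \<Sum>j<d. (a i j)\<^sup>2) + (\<Sum>j<d. \<Sum>i<n. Ex (\<lambda>\<omega>. (e \<omega> i j)\<^sup>2))"
proof -
  have "Ex (\<lambda>\<omega>. (a i j + e \<omega> i j)\<^sup>2) = (a i j)\<^sup>2 + Ex (\<lambda>\<omega>. (e \<omega> i j)\<^sup>2)" if "i < n" "j < d" for i j
    using that by (simp add: power2_sum)
  hence "Ex (\<lambda>\<omega>. \<Sum>i<n. \<Sum>j<d. (a i j + e \<omega> i j)\<^sup>2)
      = (\<Sum>i<n. \<Sum>j<d. (a i j)\<^sup>2 + Ex (\<lambda>\<omega>. (e \<omega> i j)\<^sup>2))" by simp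
  thus ?thesis by (simp add: sum.distrib) (rule sum.swap)
qed

text \<open>This concerns coordinate j of E^T E y. Its diagonal part, y_j times the squared norm of
  column j, need not be centred and is bounded outright through n r^2; the products of entries from
  column j and another column are uncorrelated, so their squares contribute only order n.\<close>

lemma Ex_gram_column_square_le:
  assumes j: "j < d"
  shows "Ex (\<lambda>\<omega>. (\<Sum>i<n. e \<omega> i j * mat_apply d (e \<omega>) y i)\<^sup>2)
    \<le> 2 * (y j)\<^sup>2 * (real n)\<^sup>2 * r ^ 4 + 2 * real n * r ^ 4 * (\<Sum>l<d. (y l)\<^sup>2)"
proof -
  let ?S = "{..<n} \<times> ({..<d} - {j})"
  define D where "D \<omega> = y j * (\<Sum>i<n. (e \<omega> i j)\<^sup>2)" for \<omega>
  define V where "V \<omega> = (\<Sum>s\<in>?S. y (snd s) * (e \<omega> (fst s) j * e \<omega> (fst s) (snd s)))" for \<omega>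
  have split: "(\<Sum>i<n. e \<omega> i j * mat_apply d (e \<omega>) y i) = D \<omega> + V \<omega>" for \<omega>
  proof -
    have "mat_apply d (e \<omega>) y i = e \<omega> i j * y j + (\<Sum>l\<in>{..<d} - {j}. e \<omega> i l * y l)" for i
      unfolding mat_apply_def using j by (simp add: sum.remove[of "{..<d}" j])
    hence "(\<Sum>i<n. e \<omega> i j * mat_apply d (e \<omega>) y i)
      = D \<omega> + (\<Sum>i<n. \<Sum>l\<in>{..<d} - {j}. y l * (e \<omega> i j * e \<omega> i l))"
      by (simp add: D_def distrib_left sum.distrib sum_distrib_left power2_eq_square mult_ac)
    thus ?thesis by (simp add: V_def sum.cartesian_product case_prod_beta)
  qed
  have D: "(D \<omega>)\<^sup>2 \<le> (y j)\<^sup>2 * (real n)\<^sup>2 * r ^ 4" if "\<omega> \<in> set_pmf law" for \<omega>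
  proof -
    have "(\<Sum>i<n. (e \<omega> i j)\<^sup>2) \<le> (\<Sum>i<n. r\<^sup>2)"
      by (intro sum_mono e_square_bound that j) simp
    hence "(\<Sum>i<n. (e \<omega> i j)\<^sup>2)\<^sup>2 \<le> (real n * r\<^sup>2)\<^sup>2"
      by (intro power_mono) (auto intro: sum_nonneg)
    thus ?thesis
      unfolding D_def power_mult_distrib using mult_left_mono[of _ _ "(y j)\<^sup>2"]
      by (simp add: mult.assoc power_mult_distrib flip: power_mult)
  qed
  have "Ex (\<lambda>\<omega>. (V \<omega>)\<^sup>2)
      = (\<Sum>s\<in>?S. (y (snd s))\<^sup>2 * Ex (\<lambda>\<omega>. (e \<omega> (fst s) j * e \<omega> (fst s) (snd s))\<^sup>2))"
    unfolding V_def
  proof (rule expectation_square_uncorrelated[OF finite_law])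
    fix s t assume st: "s \<in> ?S" "t \<in> ?S" "s \<noteq> t"
    obtain i l i' l' where s: "s = (i, l)" and t: "t = (i', l')" by (metis surj_pair)
    \<comment> \<open>The entry \<open>(i, l)\<close> occurs exactly once among the four factors, since \<open>l \<noteq> j\<close>.\<close>
    have "Ex (\<lambda>\<omega>. e \<omega> i l * (e \<omega> i j * (e \<omega> i' j * e \<omega> i' l'))) = 0"
      by (rule Ex_e_times) (use st s t in \<open>auto simp: e_def\<close>)
    thus "Ex (\<lambda>\<omega>. e \<omega> (fst s) j * e \<omega> (fst s) (snd s) * (e \<omega> (fst t) j * e \<omega> (fst t) (snd t))) = 0"
      by (simp add: s t mult_ac)
  qed simp
  also have "\<dots> \<le> (\<Sum>s\<in>?S. (y (snd s))\<^sup>2 * r ^ 4)"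
  proof (intro sum_mono mult_left_mono)
    fix s assume s: "s \<in> ?S"
    have "(e \<omega> (fst s) j * e \<omega> (fst s) (snd s))\<^sup>2 \<le> r ^ 4" if "\<omega> \<in> set_pmf law" for \<omega>
    proof -
      have "(e \<omega> (fst s) j)\<^sup>2 * (e \<omega> (fst s) (snd s))\<^sup>2 \<le> r\<^sup>2 * r\<^sup>2"
        by (intro mult_mono e_square_bound that) (use s j in auto)
      thus ?thesis by (simp add: power_mult_distrib flip: power_add)
    qed
    thus "Ex (\<lambda>\<omega>. (e \<omega> (fst s) j * e \<omega> (fst s) (snd s))\<^sup>2) \<le> r ^ 4"
      using Ex_mono[of "\<lambda>\<omega>. (e \<omega> (fst s) j * e \<omega> (fst s) (snd s))\<^sup>2" "\<lambda>_. r ^ 4"] by simp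
  qed simp
  also have "\<dots> = real n * r ^ 4 * (\<Sum>l\<in>{..<d} - {j}. (y l)\<^sup>2)"
    using sum.cartesian_product[of "\<lambda>_ l. (y l)\<^sup>2 * r ^ 4" "{..<d} - {j}" "{..<n}"]
    by (simp add: case_prod_beta sum_distrib_left mult_ac)
  also have "\<dots> \<le> real n * r ^ 4 * (\<Sum>l<d. (y l)\<^sup>2)"
    by (intro mult_left_mono sum_mono2) auto
  finally have V: "Ex (\<lambda>\<omega>. (V \<omega>)\<^sup>2) \<le> real n * r ^ 4 * (\<Sum>l<d. (y l)\<^sup>2)" .
  have two: "(p + q)\<^sup>2 \<le> 2 * p\<^sup>2 + 2 * q\<^sup>2" for p q :: real
    using zero_le_power2[of "p - q"] by (simp add: power2_eq_square algebra_simps)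
  have "Ex (\<lambda>\<omega>. (D \<omega> + V \<omega>)\<^sup>2) \<le> Ex (\<lambda>\<omega>. 2 * ((y j)\<^sup>2 * (real n)\<^sup>2 * r ^ 4) + 2 * (V \<omega>)\<^sup>2)"
    by (rule Ex_mono) (use two D in \<open>smt (verit)\<close>)
  also have "\<dots> = 2 * ((y j)\<^sup>2 * (real n)\<^sup>2 * r ^ 4) + 2 * Ex (\<lambda>\<omega>. (V \<omega>)\<^sup>2)" by simp
  finally show ?thesis using V by (simp add: split)
qed

text \<open>By Parseval the sum over c is the squared norm of E^T E u_b, bounded coordinate by
  coordinate; d <= n absorbs the off-diagonal n d r^4. The outright Frobenius bound would only give
  n^2 d^2 r^4.\<close>

lemma Ex_noise_gram_le:
  assumes u: "orthonormal_basis d u" and b: "b < d" and dn: "d \<le> n"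
  shows "(\<Sum>c<d. Ex (\<lambda>\<omega>. (\<Sum>i<n. mat_apply d (e \<omega>) (u b) i * mat_apply d (e \<omega>) (u c) i)\<^sup>2))
    \<le> 4 * (real n)\<^sup>2 * r ^ 4"
proof -
  define g where "g \<omega> j = (\<Sum>i<n. e \<omega> i j * mat_apply d (e \<omega>) (u b) i)" for \<omega> j
  have unit: "(\<Sum>l<d. (u b l)\<^sup>2) = 1"
    using u b by (simp add: orthonormal_basis_def power2_eq_square)
  have "(\<Sum>i<n. mat_apply d (e \<omega>) (u b) i * mat_apply d (e \<omega>) (u c) i) = (\<Sum>j<d. u c j * g \<omega> j)" for \<omega> c
    unfolding g_def mat_apply_def[of d "e \<omega>" "u c"] sum_distrib_left
    by (subst sum.swap) (simp add: mult_ac)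
  hence "(\<Sum>c<d. Ex (\<lambda>\<omega>. (\<Sum>i<n. mat_apply d (e \<omega>) (u b) i * mat_apply d (e \<omega>) (u c) i)\<^sup>2))
      = Ex (\<lambda>\<omega>. \<Sum>c<d. (\<Sum>j<d. u c j * g \<omega> j)\<^sup>2)" by simp
  also have "\<dots> = (\<Sum>j<d. Ex (\<lambda>\<omega>. (g \<omega> j)\<^sup>2))"
    by (simp add: orthonormal_basis_parseval[OF u])
  also have "\<dots> \<le> (\<Sum>j<d. 2 * (u b j)\<^sup>2 * (real n)\<^sup>2 * r ^ 4 + 2 * real n * r ^ 4)"
    unfolding g_def using Ex_gram_column_square_le[of _ "u b"] unit by (intro sum_mono) auto
  also have "\<dots> = 2 * (real n)\<^sup>2 * r ^ 4 * (\<Sum>j<d. (u b j)\<^sup>2) + 2 * real n * r ^ 4 * real d"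
    by (simp add: sum.distrib sum_distrib_left mult_ac)
  also have "\<dots> \<le> 2 * (real n)\<^sup>2 * r ^ 4 + 2 * real n * r ^ 4 * real n"
    unfolding unit using dn by (intro add_mono mult_left_mono) auto
  finally show ?thesis by (simp add: power2_eq_square algebra_simps)
qed

text \<open>For b < k <= c the vectors A u_b and A u_c are orthogonal, so only terms with E remain.
  The factor 3 of the three-term square yields 6 = 3 * 2 for the two linear terms and 12 = 3 * 4 for
  the quadratic one.\<close>

lemma Ex_off_diagonal_block_le:
  assumes u: "orthonormal_basis d u" and k: "k \<le> d" and dn: "d \<le> n"
    and gram: "\<And>b c. b < d \<Longrightarrow> c < d \<Longrightarrow>
       (\<Sum>i<n. mat_apply d a (u b) i * mat_apply d a (u c) i) = (if b = c then \<mu> b else 0)"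
    and \<Lambda>: "\<And>b. b < d \<Longrightarrow> \<mu> b \<le> \<Lambda>"
  shows "Ex (\<lambda>\<omega>. \<Sum>b<k. \<Sum>c\<in>{k..<d}.
      (\<Sum>i<n. mat_apply d (\<lambda>i j. a i j + e \<omega> i j) (u b) i
           * mat_apply d (\<lambda>i j. a i j + e \<omega> i j) (u c) i)\<^sup>2)
    \<le> 6 * \<Lambda> * real k * real (d - k) * r\<^sup>2 + 12 * real k * (real n)\<^sup>2 * r ^ 4"
proof -
  define E2 where "E2 b c = Ex (\<lambda>\<omega>. (\<Sum>i<n. mat_apply d (e \<omega>) (u b) i * mat_apply d (e \<omega>) (u c) i)\<^sup>2)" for b c
  have unit: "(\<Sum>l<d. (u b l)\<^sup>2) = 1" if "b < d" for b
    using u that by (simp add: orthonormal_basis_def power2_eq_square)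
  have cross: "Ex (\<lambda>\<omega>. (\<Sum>i<n. mat_apply d a (u b) i * mat_apply d (e \<omega>) (u c) i)\<^sup>2) \<le> r\<^sup>2 * \<Lambda>"
    if "b < d" "c < d" for b c
  proof -
    have "r\<^sup>2 * (\<Sum>i<n. (mat_apply d a (u b) i)\<^sup>2) \<le> r\<^sup>2 * \<Lambda>"
      using gram[OF that(1) that(1)] \<Lambda>[OF that(1)] by (intro mult_left_mono) (auto simp: power2_eq_square)
    thus ?thesis
      using Ex_bilinear_square_le[of "mat_apply d a (u b)" "u c"] unit[OF that(2)] by simp
  qed
  have three: "(p + q + s)\<^sup>2 \<le> 3 * (p\<^sup>2 + q\<^sup>2 + s\<^sup>2)" for p q s :: real
    using zero_le_power2[of "p - q"] zero_le_power2[of "p - s"] zero_le_power2[of "q - s"]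
    by (simp add: power2_eq_square algebra_simps)
  have each: "Ex (\<lambda>\<omega>. (\<Sum>i<n. mat_apply d (\<lambda>i j. a i j + e \<omega> i j) (u b) i
           * mat_apply d (\<lambda>i j. a i j + e \<omega> i j) (u c) i)\<^sup>2) \<le> 3 * (2 * (r\<^sup>2 * \<Lambda>) + E2 b c)"
    if bc: "b < k" "c \<in> {k..<d}" for b c
  proof -
    have bc': "b < d" "c < d" "b \<noteq> c" using bc k by auto
    define p where "p \<omega> = (\<Sum>i<n. mat_apply d a (u b) i * mat_apply d (e \<omega>) (u c) i)" for \<omega>
    define q' where "q' \<omega> = (\<Sum>i<n. mat_apply d a (u c) i * mat_apply d (e \<omega>) (u b) i)" for \<omega>
    define s where "s \<omega> = (\<Sum>i<n. mat_apply d (e \<omega>) (u b) i * mat_apply d (e \<omega>) (u c) i)" for \<omega>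
    have "(\<Sum>i<n. mat_apply d (\<lambda>i j. a i j + e \<omega> i j) (u b) i
           * mat_apply d (\<lambda>i j. a i j + e \<omega> i j) (u c) i)
        = (\<Sum>i<n. mat_apply d a (u b) i * mat_apply d a (u c) i) + p \<omega> + q' \<omega> + s \<omega>" for \<omega>
      unfolding mat_apply_add p_def q'_def s_def sum.distrib[symmetric]
      by (intro sum.cong refl) (simp add: algebra_simps)
    hence "Ex (\<lambda>\<omega>. (\<Sum>i<n. mat_apply d (\<lambda>i j. a i j + e \<omega> i j) (u b) i
           * mat_apply d (\<lambda>i j. a i j + e \<omega> i j) (u c) i)\<^sup>2)
        = Ex (\<lambda>\<omega>. (p \<omega> + q' \<omega> + s \<omega>)\<^sup>2)"
      using gram[OF bc'(1,2)] bc'(3) by simp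
    also have "\<dots> \<le> Ex (\<lambda>\<omega>. 3 * ((p \<omega>)\<^sup>2 + (q' \<omega>)\<^sup>2 + (s \<omega>)\<^sup>2))"
      by (intro Ex_mono three)
    also have "\<dots> = 3 * (Ex (\<lambda>\<omega>. (p \<omega>)\<^sup>2) + Ex (\<lambda>\<omega>. (q' \<omega>)\<^sup>2) + E2 b c)"
      by (simp add: E2_def s_def)
    also have "\<dots> \<le> 3 * (2 * (r\<^sup>2 * \<Lambda>) + E2 b c)"
      using cross[OF bc'(1,2)] cross[OF bc'(2,1)] by (simp add: p_def q'_def)
    finally show ?thesis .
  qed
  have E2: "(\<Sum>c\<in>{k..<d}. E2 b c) \<le> 4 * (real n)\<^sup>2 * r ^ 4" if "b < k" for b
  proof -
    have "(\<Sum>c\<in>{k..<d}. E2 b c) \<le> (\<Sum>c<d. E2 b c)"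
      by (intro sum_mono2) (auto simp: E2_def)
    thus ?thesis using Ex_noise_gram_le[OF u _ dn, of b] that k by (simp add: E2_def)
  qed
  have "Ex (\<lambda>\<omega>. \<Sum>b<k. \<Sum>c\<in>{k..<d}.
      (\<Sum>i<n. mat_apply d (\<lambda>i j. a i j + e \<omega> i j) (u b) i
           * mat_apply d (\<lambda>i j. a i j + e \<omega> i j) (u c) i)\<^sup>2)
      = (\<Sum>b<k. \<Sum>c\<in>{k..<d}. Ex (\<lambda>\<omega>. (\<Sum>i<n. mat_apply d (\<lambda>i j. a i j + e \<omega> i j) (u b) i
           * mat_apply d (\<lambda>i j. a i j + e \<omega> i j) (u c) i)\<^sup>2))"
    by simp
  also have "\<dots> \<le> (\<Sum>b<k. \<Sum>c\<in>{k..<d}. 3 * (2 * (r\<^sup>2 * \<Lambda>) + E2 b c))"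
    by (intro sum_mono each) auto
  also have "\<dots> = (\<Sum>b<k. 6 * real (d - k) * (r\<^sup>2 * \<Lambda>) + 3 * (\<Sum>c\<in>{k..<d}. E2 b c))"
    by (simp add: sum.distrib sum_distrib_left distrib_left mult_ac)
  also have "\<dots> \<le> (\<Sum>b<k. 6 * real (d - k) * (r\<^sup>2 * \<Lambda>) + 3 * (4 * (real n)\<^sup>2 * r ^ 4))"
    using E2 by (intro sum_mono add_mono mult_left_mono) auto
  also have "\<dots> = 6 * \<Lambda> * real k * real (d - k) * r\<^sup>2 + 12 * real k * (real n)\<^sup>2 * r ^ 4"
    by (simp add: algebra_simps)
  finally show ?thesis .
qed

end

subsection \<open>Stochastic rounding\<close>

lemma resolution_pos: "0 < R \<Longrightarrow> 1 \<le> B \<Longrightarrow> 0 < resolution R B"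
  unfolding resolution_def
  using one_less_power[of "2::real" B] by (intro divide_pos_pos) auto

text \<open>The choice in \<open>grid_cell\<close> needs some cell containing x. The first cell
  whose right end reaches x will do: its left end does not exceed x, by minimality or, for cell 1,
  because it is \<open>- R\<close>.\<close>

lemma grid_cell_bounds:
  assumes R: "0 < R" and B: "1 \<le> B" and x: "\<bar>x\<bar> \<le> R"
  shows "grid_point R B (grid_cell R B x) \<le> x" "x \<le> grid_point R B (grid_cell R B x + 1)"
proof -
  let ?Q = "\<lambda>m. 1 \<le> m \<and> x \<le> grid_point R B (m + 1)"
  \<comment> \<open>N is the last cell: N steps of the resolution make 2 R, so its right end is
    R.\<close>
  define N where "N = (2::nat) ^ B - 1"
  have "(2::nat) ^ 1 \<le> 2 ^ B" using B by (intro power_increasing) auto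
  hence N: "1 \<le> N" "N < 2 ^ B" "real N = 2 ^ B - 1"
    by (auto simp: N_def of_nat_diff)
  have "real N * resolution R B = 2 * R"
    using N by (simp add: resolution_def flip: N(3))
  hence QN: "?Q N" using N x by (simp add: grid_point_def)
  define m where "m = (LEAST m. ?Q m)"
  have Qm: "?Q m" unfolding m_def by (rule LeastI[of ?Q, OF QN])
  have "m \<le> N" unfolding m_def by (rule Least_le[of ?Q, OF QN])
  have "grid_point R B m \<le> x"
  proof (cases "m = 1")
    case True
    thus ?thesis using x by (simp add: grid_point_def)
  next
    case False
    hence "1 \<le> m - 1" "m - 1 < m" using Qm by auto
    hence "\<not> x \<le> grid_point R B (m - 1 + 1)"
      using not_less_Least[of "m - 1" ?Q] unfolding m_def by blast
    thus ?thesis using Qm by simp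
  qed
  hence "1 \<le> m \<and> m < 2 ^ B \<and> x \<in> {grid_point R B m .. grid_point R B (m + 1)}"
    using Qm \<open>m \<le> N\<close> N(2) by auto
  from LeastI[of "\<lambda>m. 1 \<le> m \<and> m < 2 ^ B \<and> x \<in> {grid_point R B m .. grid_point R B (m + 1)}", OF this]
  show "grid_point R B (grid_cell R B x) \<le> x" "x \<le> grid_point R B (grid_cell R B x + 1)"
    unfolding grid_cell_def by auto
qed

text \<open>Both outcomes are ends of a cell of length \<open>resolution R B\<close> containing x,
  and the coin's bias is the relative position of x in it, so the mean is a linear interpolation.
  These facts instantiate \<open>matrix_noise\<close>.\<close>

lemma stochastic_round_properties:
  assumes R: "0 < R" and B: "1 \<le> B" and x: "\<bar>x\<bar> \<le> R"
  shows "finite (set_pmf (stochastic_round R B x))"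
    and "y \<in> set_pmf (stochastic_round R B x) \<Longrightarrow> \<bar>y - x\<bar> \<le> resolution R B"
    and "measure_pmf.expectation (stochastic_round R B x) (\<lambda>y. y) = x"
proof -
  define m where "m = grid_cell R B x"
  define p where "p = (x - grid_point R B m) / resolution R B"
  note \<rho> = resolution_pos[OF R B]
  note m = grid_cell_bounds[OF assms, folded m_def]
  have step: "grid_point R B (m + 1) = grid_point R B m + resolution R B"
    by (simp add: grid_point_def algebra_simps)
  have p: "0 \<le> p" "p \<le> 1" using m \<rho> step by (auto simp: p_def field_simps)
  have sr: "stochastic_round R B x
      = map_pmf (\<lambda>up. if up then grid_point R B (m + 1) else grid_point R B m) (bernoulli_pmf p)"
    unfolding stochastic_round_def Let_def m_def p_def ..
  have sub: "set_pmf (stochastic_round R B x) \<subseteq> {grid_point R B (m + 1), grid_point R B m}"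
    unfolding sr by auto
  thus "finite (set_pmf (stochastic_round R B x))" by (rule finite_subset) simp
  show "\<bar>y - x\<bar> \<le> resolution R B" if "y \<in> set_pmf (stochastic_round R B x)"
    using that sub m step by auto
  have "measure_pmf.expectation (stochastic_round R B x) (\<lambda>y. y)
      = p * grid_point R B (m + 1) + (1 - p) * grid_point R B m"
    unfolding sr using p by simp
  also have "\<dots> = grid_point R B m + p * resolution R B"
    unfolding step by (simp add: algebra_simps)
  also have "\<dots> = x" using \<rho> by (simp add: p_def)
  finally show "measure_pmf.expectation (stochastic_round R B x) (\<lambda>y. y) = x" .
qed

section \<open>Assembly of the tail energy bound\<close>

lemma sum_one_based: "(\<Sum>j = 1..k. F j) = (\<Sum>j<k. F (j + 1))" for F :: "nat \<Rightarrow> real"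
  by (rule sum.reindex_bij_witness[of _ "\<lambda>j. j + 1" "\<lambda>j. j - 1"]) auto

lemma sum_one_based_split:
  fixes F :: "nat \<Rightarrow> real"
  assumes "k \<le> d"
  shows "(\<Sum>j = k + 1..d. F j) = (\<Sum>j<d. F (j + 1)) - (\<Sum>j<k. F (j + 1))"
proof -
  have "{1..d} = {1..k} \<union> {k + 1..d}" using assms by auto
  hence "(\<Sum>j = 1..d. F j) = (\<Sum>j = 1..k. F j) + (\<Sum>j = k + 1..d. F j)"
    by (simp add: sum.union_disjoint)
  thus ?thesis unfolding sum_one_based by simp
qed

lemma sum_kth_largest:
  "(\<Sum>j<d. kth_largest (image_mset f (mset_set {..<d})) (j + 1)) = (\<Sum>j<d. f j)"
proof -
  obtain \<pi> where \<pi>: "\<pi> permutes {..<d}"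
    "\<And>j. j < d \<Longrightarrow> kth_largest (image_mset f (mset_set {..<d})) (j + 1) = f (\<pi> j)"
    by (rule mset_real_enumeration[of d f]) blast
  show ?thesis
    using sum.permute[OF \<pi>(1), of f] \<pi>(2) by (simp add: comp_def)
qed

lemma excess_tail_energy_ge:
  fixes A :: "real mat"
  assumes dn: "d \<le> n" and k: "1 \<le> k" "k < d" and A: "A \<in> carrier_mat n d"
    and R: "0 < R" and AR: "\<And>i j. i < n \<Longrightarrow> j < d \<Longrightarrow> \<bar>A $$ (i, j)\<bar> \<le> R" and B: "1 \<le> B"
  defines "\<rho> \<equiv> resolution R B" and "\<sigma> \<equiv> singular_value A"
  assumes noise: "\<rho> * sqrt (real n * real d) \<le> 1 / 64 * \<sigma> k"
    and cond: "\<sigma> 1 \<le> 2 * \<sigma> k"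
    and gap: "(\<sigma> k)\<^sup>2 - (\<sigma> (k + 1))\<^sup>2 > 1 / 2 * (\<sigma> k)\<^sup>2"
  shows "excess_tail_energy R B A k \<ge> (\<Sum>j = k + 1..d. column_variance_decr R B A j)
    - 96 * (real k * real (d - k) * \<rho>\<^sup>2 + real k * (real n)\<^sup>2 * \<rho> ^ 4 / (\<sigma> k)\<^sup>2)"
proof -
  define a where "a i j = A $$ (i, j)" for i j
  define q where "q = (\<lambda>(i, j). stochastic_round R B (A $$ (i, j)))"
  interpret matrix_noise n d q a \<rho>
    by unfold_locales
      (auto simp: q_def a_def \<rho>_def intro!: stochastic_round_properties[OF R B AR])
  have dims: "dim_row A = n" "dim_col A = d" using A by auto
  have law: "stochastic_round_mat R B A = map_pmf (mat n d) law"
    unfolding stochastic_round_mat_def law_def dims unfolding q_def ..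
  define f where "f \<omega> = (\<lambda>i j. a i j + e \<omega> i j)" for \<omega>
  have f: "f \<omega> i j = \<omega> (i, j)" for \<omega> i j by (simp add: f_def e_def)
  define L where "L = (\<sigma> k)\<^sup>2"
  obtain u where u: "orthonormal_basis d u"
    and gram: "\<And>b c. b < d \<Longrightarrow> c < d \<Longrightarrow>
       (\<Sum>i<n. mat_apply d a (u b) i * mat_apply d a (u c) i) = (if b = c then (\<sigma> (b + 1))\<^sup>2 else 0)"
    and \<sigma>0: "\<And>b. b < d \<Longrightarrow> 0 \<le> \<sigma> (b + 1)"
    and \<sigma>mono: "\<And>b c. b \<le> c \<Longrightarrow> c < d \<Longrightarrow> \<sigma> (c + 1) \<le> \<sigma> (b + 1)"
    unfolding \<sigma>_def a_def by (rule singular_basis[OF A]) blast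
  have \<sigma>k: "0 \<le> \<sigma> k" using \<sigma>0[of "k - 1"] k by simp
  \<comment> \<open>If \<open>\<sigma> k\<close> were zero, the gap condition would say that minus a
    square is positive.\<close>
  have L: "0 < L" using gap \<sigma>k by (cases "\<sigma> k = 0") (auto simp: L_def)
  have \<sigma>sq: "(\<sigma> (c + 1))\<^sup>2 \<le> (\<sigma> (b + 1))\<^sup>2" if "b \<le> c" "c < d" for b c
    using that \<sigma>0 \<sigma>mono by (intro power_mono) auto
  have top: "L \<le> (\<sigma> (b + 1))\<^sup>2" if "b < k" for b
    using \<sigma>sq[of b "k - 1"] that k by (simp add: L_def)
  have low: "(\<sigma> (b + 1))\<^sup>2 \<le> L / 2" if "k \<le> b" "b < d" for b
    using \<sigma>sq[of k b] that gap by (simp add: L_def)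
  have max: "(\<sigma> (b + 1))\<^sup>2 \<le> 4 * L" if "b < d" for b
  proof -
    have "(\<sigma> (b + 1))\<^sup>2 \<le> (\<sigma> 1)\<^sup>2" using \<sigma>sq[of 0 b] that by simp
    also have "\<dots> \<le> (2 * \<sigma> k)\<^sup>2" using cond \<sigma>0[of 0] k by (intro power_mono) auto
    finally show ?thesis by (simp add: L_def power_mult_distrib)
  qed
  have \<rho>0: "0 < \<rho>" unfolding \<rho>_def by (rule resolution_pos[OF R B])
  have "(\<rho> * sqrt (real n * real d))\<^sup>2 \<le> (1 / 64 * \<sigma> k)\<^sup>2"
    using noise \<rho>0 by (intro power_mono) auto
  hence ndL: "real n * real d * \<rho>\<^sup>2 \<le> L / 4096"
    by (simp add: power_mult_distrib L_def power_divide mult_ac)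
  define top_energy where "top_energy \<omega> = (\<Sum>b<k. \<Sum>i<n. (mat_apply d (f \<omega>) (u b) i)\<^sup>2)" for \<omega>
  define block where "block \<omega> = (\<Sum>b<k. \<Sum>c\<in>{k..<d}.
      (\<Sum>i<n. mat_apply d (f \<omega>) (u b) i * mat_apply d (f \<omega>) (u c) i)\<^sup>2)" for \<omega>
  \<comment> \<open>The singular basis v varies with \<omega> and is eliminated here, before any
    expectation is taken; the left side is a polynomial in the entries of \<omega>.\<close>
  have pointwise: "(\<Sum>i<n. \<Sum>j<d. (f \<omega> i j)\<^sup>2) - (top_energy \<omega> + 4 / L * block \<omega>)
      \<le> (\<Sum>i = k + 1..d. (singular_value (mat n d \<omega>) i)\<^sup>2)" if \<omega>: "\<omega> \<in> set_pmf law" for \<omega>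
  proof -
    have mat_f: "mat_apply d (\<lambda>i j. mat n d \<omega> $$ (i, j)) y i = mat_apply d (f \<omega>) y i"
      if "i < n" for y i
      using that by (simp add: mat_apply_def f)
    have "mat n d \<omega> \<in> carrier_mat n d" by simp
    then obtain v where v: "orthonormal_basis d v"
      and gram_v: "\<And>b. b < d \<Longrightarrow> (\<Sum>i<n. mat_apply d (\<lambda>i j. mat n d \<omega> $$ (i, j)) (v b) i
           * mat_apply d (\<lambda>i j. mat n d \<omega> $$ (i, j)) (v b) i) = (singular_value (mat n d \<omega>) (b + 1))\<^sup>2"
      by (rule singular_basis) (metis (mono_tags))
    have sv: "(singular_value (mat n d \<omega>) (b + 1))\<^sup>2 = (\<Sum>i<n. (mat_apply d (f \<omega>) (v b) i)\<^sup>2)"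
      if "b < d" for b
      using gram_v[OF that] by (simp add: mat_f power2_eq_square)
    have "(\<Sum>i<n. \<Sum>j<d. (e \<omega> i j)\<^sup>2) \<le> (\<Sum>i<n. \<Sum>j<d. \<rho>\<^sup>2)"
      by (intro sum_mono e_square_bound \<omega>) auto
    also have "\<dots> \<le> L / 4096" using ndL by simp
    finally have e: "(\<Sum>i<n. \<Sum>j<d. (e \<omega> i j)\<^sup>2) \<le> L / 4096" .
    have "(\<Sum>b<k. \<Sum>i<n. (mat_apply d (f \<omega>) (v b) i)\<^sup>2) \<le> top_energy \<omega> + 4 / L * block \<omega>"
      unfolding top_energy_def block_def f_def
      by (rule perturbed_top_energy_le[OF u v _ gram L top low e]) (use k in auto)
    moreover have "(\<Sum>i = k + 1..d. (singular_value (mat n d \<omega>) i)\<^sup>2)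
        = (\<Sum>b<d. \<Sum>i<n. (mat_apply d (f \<omega>) (v b) i)\<^sup>2) - (\<Sum>b<k. \<Sum>i<n. (mat_apply d (f \<omega>) (v b) i)\<^sup>2)"
      using k by (subst sum_one_based_split) (auto simp: sv[simplified])
    ultimately show ?thesis by (simp add: frobenius_orthonormal_basis[OF v])
  qed
  define \<nu> where "\<nu> j = (\<Sum>i<n. Ex (\<lambda>\<omega>. (e \<omega> i j)\<^sup>2))" for j
  have var: "column_variance R B A j = \<nu> j" if j: "j < d" for j
    unfolding column_variance_def \<nu>_def dims law
  proof (intro sum.cong refl)
    fix i assume "i \<in> {..<n}"
    hence i: "i < n" by simp
    have ent: "(mat n d \<omega> - A) $$ (i, j) = e \<omega> i j" for \<omega>
      using i j A by (simp add: e_def a_def)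
    \<comment> \<open>Variance and second moment agree because the entry of the noise is
      centred.\<close>
    show "measure_pmf.variance (map_pmf (mat n d) law) (\<lambda>A'. (A' - A) $$ (i, j)) = Ex (\<lambda>\<omega>. (e \<omega> i j)\<^sup>2)"
      using i j by (simp add: ent)
  qed
  have decr: "column_variance_decr R B A = kth_largest (image_mset \<nu> (mset_set {..<d}))"
    unfolding column_variance_decr_def dims
    by (intro arg_cong[where f = kth_largest] image_mset_cong) (simp add: var)
  have Ex_top: "Ex top_energy \<le> (\<Sum>b<k. (\<sigma> (b + 1))\<^sup>2) + (\<Sum>j<k. column_variance_decr R B A (j + 1))"
  proof -
    \<comment> \<open>\<open>p j\<close> is the j-th diagonal entry of the orthogonal projection
      onto the span of the first k vectors; hence it lies in [0, 1] and the sum is the trace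
      k.\<close>
    define p where "p j = (\<Sum>b<k. (u b j)\<^sup>2)" for j
    have "Ex top_energy = (\<Sum>b<k. Ex (\<lambda>\<omega>. \<Sum>i<n. (mat_apply d (f \<omega>) (u b) i)\<^sup>2))"
      unfolding top_energy_def by (subst Bochner_Integration.integral_sum) auto
    also have "\<dots> = (\<Sum>b<k. (\<Sum>i<n. (mat_apply d a (u b) i)\<^sup>2) + (\<Sum>j<d. \<nu> j * (u b j)\<^sup>2))"
      unfolding f_def \<nu>_def by (intro sum.cong refl Ex_column_energy)
    also have "\<dots> = (\<Sum>b<k. (\<sigma> (b + 1))\<^sup>2) + (\<Sum>j<d. \<nu> j * p j)"
    proof -
      have "(\<Sum>i<n. (mat_apply d a (u b) i)\<^sup>2) = (\<sigma> (b + 1))\<^sup>2" if "b < k" for b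
        using gram[of b b] that k by (simp add: power2_eq_square)
      moreover have "(\<Sum>b<k. \<Sum>j<d. \<nu> j * (u b j)\<^sup>2) = (\<Sum>j<d. \<nu> j * p j)"
        unfolding p_def sum_distrib_left by (rule sum.swap)
      ultimately show ?thesis by (simp add: sum.distrib)
    qed
    also have "(\<Sum>j<d. \<nu> j * p j) \<le> (\<Sum>j = 1..k. kth_largest (image_mset \<nu> (mset_set {..<d})) j)"
    proof (rule weighted_sum_le_top_sum)
      show "0 \<le> p j" for j by (simp add: p_def sum_nonneg)
      show "p j \<le> 1" if "j < d" for j
      proof -
        have "p j \<le> (\<Sum>b<d. (u b j)\<^sup>2)" unfolding p_def using k by (intro sum_mono2) auto
        also have "\<dots> = 1" using u that by (simp add: orthonormal_basis_def power2_eq_square)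
        finally show ?thesis .
      qed
      have "(\<Sum>j<d. p j) = (\<Sum>b<k. \<Sum>j<d. (u b j)\<^sup>2)" unfolding p_def by (rule sum.swap)
      also have "\<dots> = (\<Sum>b<k. 1)"
        using u k by (intro sum.cong refl) (simp add: orthonormal_basis_def power2_eq_square)
      finally show "(\<Sum>j<d. p j) = real k" by simp
    qed (use k in auto)
    finally show ?thesis by (simp only: decr sum_one_based)
  qed
  \<comment> \<open>The bound \<Lambda> on the squared singular values is 4 L by \<open>max\<close>,
    and 6 * 4 = 24.\<close>
  have Ex_block: "Ex block \<le> 24 * L * real k * real (d - k) * \<rho>\<^sup>2 + 12 * real k * (real n)\<^sup>2 * \<rho> ^ 4"
    using Ex_off_diagonal_block_le[OF u _ dn gram max, of k] k
    by (simp add: block_def[abs_def] f_def)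
  have "(\<Sum>i<n. \<Sum>j<d. (a i j)\<^sup>2) = (\<Sum>b<d. (\<sigma> (b + 1))\<^sup>2)"
    unfolding frobenius_orthonormal_basis[OF u, symmetric]
    using gram by (intro sum.cong refl) (simp add: power2_eq_square)
  hence Ex_total: "Ex (\<lambda>\<omega>. \<Sum>i<n. \<Sum>j<d. (f \<omega> i j)\<^sup>2) = (\<Sum>b<d. (\<sigma> (b + 1))\<^sup>2) + (\<Sum>j<d. \<nu> j)"
    unfolding f_def \<nu>_def by (simp only: Ex_frobenius)
  have tail_var: "(\<Sum>j = k + 1..d. column_variance_decr R B A j)
      = (\<Sum>j<d. \<nu> j) - (\<Sum>j<k. column_variance_decr R B A (j + 1))"
    using k by (subst sum_one_based_split) (simp_all only: decr sum_kth_largest less_imp_le)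
  have "Ex (\<lambda>\<omega>. (\<Sum>i<n. \<Sum>j<d. (f \<omega> i j)\<^sup>2) - (top_energy \<omega> + 4 / L * block \<omega>))
      \<le> Ex (\<lambda>\<omega>. \<Sum>i = k + 1..d. (singular_value (mat n d \<omega>) i)\<^sup>2)"
    by (rule Ex_mono[OF pointwise])
  moreover have "Ex (\<lambda>\<omega>. (\<Sum>i<n. \<Sum>j<d. (f \<omega> i j)\<^sup>2) - (top_energy \<omega> + 4 / L * block \<omega>))
      = Ex (\<lambda>\<omega>. \<Sum>i<n. \<Sum>j<d. (f \<omega> i j)\<^sup>2) - (Ex top_energy + 4 / L * Ex block)"
    by (subst Bochner_Integration.integral_diff, simp, simp, subst Bochner_Integration.integral_add) simp_all
  \<comment> \<open>The factor 4 / L turns 24 L into 96 and 12 into 48 / L; 48 is raised to 96 to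
    share one constant.\<close>
  moreover have "4 / L * Ex block \<le> 96 * (real k * real (d - k) * \<rho>\<^sup>2 + real k * (real n)\<^sup>2 * \<rho> ^ 4 / L)"
  proof -
    have "4 / L * Ex block
        \<le> 4 / L * (24 * L * real k * real (d - k) * \<rho>\<^sup>2 + 12 * real k * (real n)\<^sup>2 * \<rho> ^ 4)"
      using L by (intro mult_left_mono Ex_block) auto
    also have "\<dots> = 96 * (real k * real (d - k) * \<rho>\<^sup>2) + 48 * (real k * (real n)\<^sup>2 * \<rho> ^ 4 / L)"
      using L by (simp add: field_simps)
    also have "\<dots> \<le> 96 * (real k * real (d - k) * \<rho>\<^sup>2) + 96 * (real k * (real n)\<^sup>2 * \<rho> ^ 4 / L)"
      using L by (intro add_mono mult_right_mono) auto
    finally show ?thesis by (simp add: distrib_left)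
  qed
  moreover have "excess_tail_energy R B A k = Ex (\<lambda>\<omega>. \<Sum>i = k + 1..d. (singular_value (mat n d \<omega>) i)\<^sup>2)
      - ((\<Sum>b<d. (\<sigma> (b + 1))\<^sup>2) - (\<Sum>b<k. (\<sigma> (b + 1))\<^sup>2))"
    using k unfolding excess_tail_energy_def law dims \<sigma>_def[symmetric]
    by (subst sum_one_based_split[of k d "\<lambda>i. (\<sigma> i)\<^sup>2", symmetric]) auto
  ultimately show ?thesis
    using Ex_top unfolding Ex_total tail_var L_def[symmetric] by linarith
qed

text \<open>C is chosen before all the data, so it is absolute as well. The bounds
  \<open>1 < c\<^sub>2\<close> and \<open>c\<^sub>g < 1\<close> exclude a degenerate choice, since
  \<open>\<sigma> 1\<close> is never below \<open>\<sigma> k\<close> and g never exceeds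
  \<open>(\<sigma> k)\<^sup>2\<close>.\<close>

theorem mainTheorem4:
  shows "\<exists>c\<^sub>1 c\<^sub>2 c\<^sub>3 c\<^sub>g :: real. 0 < c\<^sub>1 \<and> 1 < c\<^sub>2 \<and> 0 < c\<^sub>3 \<and> 0 < c\<^sub>g \<and> c\<^sub>g < 1 \<and>
    (\<exists>C > 0. \<forall>(n :: nat) (d :: nat) (k :: nat) (A :: real mat) (R :: real) (B :: nat).
      d \<le> n \<longrightarrow> 1 \<le> k \<longrightarrow> k < d \<longrightarrow>
      A \<in> carrier_mat n d \<longrightarrow>
      0 < R \<longrightarrow> (\<forall>i<n. \<forall>j<d. \<bar>A $$ (i, j)\<bar> \<le> R) \<longrightarrow> 1 \<le> B \<longrightarrow>
      full_column_rank A \<longrightarrow>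
      (AE A' in measure_pmf (stochastic_round_mat R B A). full_column_rank A') \<longrightarrow>
      (let \<rho> = resolution R B; \<sigma> = singular_value A; g = (\<sigma> k)\<^sup>2 - (\<sigma> (k + 1))\<^sup>2
       in \<rho> * sqrt (real n * real d) \<le> c\<^sub>1 * \<sigma> k \<longrightarrow>
          \<sigma> 1 \<le> c\<^sub>2 * \<sigma> k \<longrightarrow>
          real d \<ge> c\<^sub>3 * sqrt (real n) \<longrightarrow>
          g > c\<^sub>g * (\<sigma> k)\<^sup>2 \<longrightarrow>
          excess_tail_energy R B A k \<ge>
            (\<Sum>j = k + 1..d. column_variance_decr R B A j)
            - C * (real k * real (d - k) * \<rho>\<^sup>2
                   + real k * (real n)\<^sup>2 * \<rho> ^ 4 / (\<sigma> k)\<^sup>2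
                   + real d powr (5 / 2) * \<rho> ^ 3 / \<sigma> k)))"
proof -
  define P where "P = (\<lambda>(n :: nat) (d :: nat) (k :: nat) (A :: real mat) (R :: real) (B :: nat).
      excess_tail_energy R B A k \<ge>
            (\<Sum>j = k + 1..d. column_variance_decr R B A j)
            - 96 * (real k * real (d - k) * (resolution R B)\<^sup>2
                   + real k * (real n)\<^sup>2 * (resolution R B) ^ 4 / (singular_value A k)\<^sup>2
                   + real d powr (5 / 2) * (resolution R B) ^ 3 / singular_value A k))"
  have main: "P n d k A R B"
    if "d \<le> n" "1 \<le> k" "k < d" and A: "A \<in> carrier_mat n d" and "0 < R"
      "\<forall>i<n. \<forall>j<d. \<bar>A $$ (i, j)\<bar> \<le> R" "1 \<le> B"
      "resolution R B * sqrt (real n * real d) \<le> 1 / 64 * singular_value A k"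
      "singular_value A 1 \<le> 2 * singular_value A k"
      "(singular_value A k)\<^sup>2 - (singular_value A (k + 1))\<^sup>2 > 1 / 2 * (singular_value A k)\<^sup>2"
    for n d k A R B
  proof -
    \<comment> \<open>This makes the third error term nonnegative, so subtracting it as well keeps
      the inequality of \<open>excess_tail_energy_ge\<close>.\<close>
    have "0 \<le> singular_value A k"
      using singular_basis[OF A] \<open>1 \<le> k\<close> \<open>k < d\<close>
      by (metis Suc_eq_plus1 Suc_pred less_eq_Suc_le less_imp_diff_less One_nat_def)
    hence "0 \<le> 96 * (real d powr (5 / 2) * (resolution R B) ^ 3 / singular_value A k)"
      using resolution_pos[OF \<open>0 < R\<close> \<open>1 \<le> B\<close>] by simp
    thus ?thesis
      using excess_tail_energy_ge[of d n k A R B] that unfolding P_def distrib_left by force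
  qed
  show ?thesis
    by (rule exI[of _ "1 / 64"], rule exI[of _ 2], rule exI[of _ 1], rule exI[of _ "1 / 2"],
        intro conjI exI[of _ 96])
      (use main in \<open>simp_all add: Let_def P_def\<close>)
qed

end
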